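(* Let $\Gamma$ be a closed subset of $\overline{\Omega}$, let $u$ be the elastic solution and let $\sigma(x):=\partial f(x,\nabla u(x))$ be its stress. Then $$\int_\Omega\big[f(x,\nabla u)-f(x,\nabla u_\Gamma)\big]\,dx\le\int_\Omega[\tau-\sigma]\cdot\big[\partial f^*(x,\tau)-\partial f^*(x,\sigma)\big]\,dx$$ for every $\tau\in L^q(\Omega;\mathbb{R}^N)$, $q=p/(p-1)$, such that $$\int_\Omega\tau\cdot\nabla v\,dx=0\qquad\text{for all }v\in\mathcal{A}(\Gamma).$$
   Context: $\Omega\subset\mathbb{R}^N$ is a bounded connected open set with Lipschitz boundary; $\partial_D\Omega\subseteq\partial\Omega$ is open in the relative topology of $\partial\Omega$. $1<p<+\infty$. $f:\Omega\times\mathbb{R}^N\to\mathbb{R}$ is a Carathéodory function such that $\xi\mapsto f(x,\xi)$ is strictly convex and $C^1$ for a.e. $x\in\Omega$, $f(x,0)=0$ for a.e. $x\in\Omega$, and $a|\xi|^p\le f(x,\xi)\le b(|\xi|^p+1)$ for a.e. $x\in\Omega$ and all $\xi\in\mathbb{R}^N$, with constants $a,b>0$. $\psi\in W^{1,p}(\Omega)\cap L^\infty(\Omega)$. $\partial f(x,\xi)$ is the gradient of $f$ with respect to $\xi$; $f^*(x,\zeta):=\sup\{\zeta\cdot\xi-f(x,\xi):\xi\in\mathbb{R}^N\}$ is the convex conjugate in the second variable, which is $C^1$ in $\zeta$, and $\partial f^*(x,\zeta)$ is its gradient with respect to $\zeta$. For $\Gamma\subseteq\overline\Omega$ closed, $u_\Gamma\in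 W^{1,p}(\Omega\setminus\Gamma)\cap L^\infty(\Omega\setminus\Gamma)$ denotes a minimizer of $$\min\Big\{\int_\Omega f(x,\nabla v)\,dx:\ v\in W^{1,p}(\Omega\setminus\Gamma),\ v=\psi\text{ on }\partial_D\Omega\setminus\Gamma\Big\}$$ (boundary values in the sense of traces; the gradient $\nabla u_\Gamma$ is uniquely determined). The elastic solution $u$ is the minimizer for $\Gamma=\emptyset$. Finally $$\mathcal{A}(\Gamma):=\{v\in W^{1,p}(\Omega\setminus\Gamma):\ v=0\text{ on }\partial_D\Omega\setminus\Gamma\}.$$
   Formalization: The energies, the left-hand integral and the constraint on τ are taken over Ω∖Γ, where ∇u_Γ and ∇v exist; this equals the printed formula if Γ has measure zero, while for positive measure the printed left side is undefined, and false if ∇u_Γ is extended by zero. *)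

theory Defs
  imports "HOL-Analysis.Analysis"
begin

subsection \<open>Calculus and convexity\<close>

definition gradient :: "('a::euclidean_space \<Rightarrow> real) \<Rightarrow> 'a \<Rightarrow> 'a" where
  "gradient F x = (THE D. GDERIV F x :> D)"

definition C1_fun :: "('a::euclidean_space \<Rightarrow> real) \<Rightarrow> bool" where
  "C1_fun F \<longleftrightarrow> (\<forall>x. F differentiable at x) \<and> continuous_on UNIV (gradient F)"

primrec Ck_fun :: "nat \<Rightarrow> ('a::euclidean_space \<Rightarrow> real) \<Rightarrow> bool" where
  "Ck_fun 0 F = continuous_on UNIV F"
| "Ck_fun (Suc k) F =
     ((\<forall>x. F differentiable at x) \<and> (\<forall>e\<in>Basis. Ck_fun k (\<lambda>x. gradient F x \<bullet> e)))"

definition smooth_fun :: "('a::euclidean_space \<Rightarrow> real) \<Rightarrow> bool" where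
  "smooth_fun F \<longleftrightarrow> (\<forall>k. Ck_fun k F)"

definition strictly_convex :: "('a::real_vector \<Rightarrow> real) \<Rightarrow> bool" where
  "strictly_convex F \<longleftrightarrow>
     (\<forall>x y t. x \<noteq> y \<longrightarrow> 0 < t \<longrightarrow> t < 1 \<longrightarrow>
        F ((1 - t) *\<^sub>R x + t *\<^sub>R y) < (1 - t) * F x + t * F y)"

text \<open>The supremum is taken in the reals, hence is meaningful only where it is finite. This is
  the case for every \<open>\<zeta>\<close> if \<open>F\<close> has superlinear growth.\<close>

definition convex_conjugate :: "('a::euclidean_space \<Rightarrow> real) \<Rightarrow> 'a \<Rightarrow> real" where
  "convex_conjugate F \<zeta> = (SUP \<xi>. \<zeta> \<bullet> \<xi> - F \<xi>)"

definition caratheodory :: "'a::euclidean_space set \<Rightarrow> ('a \<Rightarrow> 'a \<Rightarrow> real) \<Rightarrow> bool" where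
  "caratheodory \<Omega> f \<longleftrightarrow>
     (\<forall>\<xi>. (\<lambda>x. f x \<xi>) \<in> borel_measurable (lebesgue_on \<Omega>)) \<and>
     (AE x in lebesgue_on \<Omega>. continuous_on UNIV (f x))"

subsection \<open>Lipschitz boundary\<close>

text \<open>Near each boundary point, \<open>\<Omega>\<close> is the strict epigraph, in some direction \<open>e\<close>, of a Lipschitz
  function \<open>\<gamma>\<close> on the hyperplane orthogonal to \<open>e\<close>.\<close>

definition lipschitz_boundary :: "'a::euclidean_space set \<Rightarrow> bool" where
  "lipschitz_boundary \<Omega> \<longleftrightarrow>
     (\<forall>z\<in>frontier \<Omega>. \<exists>r>0. \<exists>e L \<gamma>. norm e = 1 \<and> L-lipschitz_on {y. y \<bullet> e = 0} \<gamma> \<and>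
        \<Omega> \<inter> ball z r = {y \<in> ball z r. \<gamma> (y - (y \<bullet> e) *\<^sub>R e) < y \<bullet> e})"

subsection \<open>Hausdorff measure\<close>

text \<open>The empty set needs a separate case because \<open>diameter {} ^ 0 = 1\<close>.\<close>

definition hausdorff_premeasure :: "nat \<Rightarrow> real \<Rightarrow> 'a::euclidean_space set \<Rightarrow> ennreal" where
  "hausdorff_premeasure s \<delta> A =
     (INF E \<in> {E :: nat \<Rightarrow> 'a set. A \<subseteq> (\<Union>i. E i) \<and> (\<forall>i. bounded (E i) \<and> diameter (E i) \<le> \<delta>)}.
        \<Sum>i. if E i = {} then 0
            else ennreal (unit_ball_vol (real s) * (diameter (E i) / 2) ^ s))"

definition hausdorff_outer :: "nat \<Rightarrow> 'a::euclidean_space set \<Rightarrow> ennreal" where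
  "hausdorff_outer s A = (SUP \<delta>\<in>{0<..}. hausdorff_premeasure s \<delta> A)"

definition hausdorff_measure :: "nat \<Rightarrow> 'a::euclidean_space measure" where
  "hausdorff_measure s = measure_of UNIV (sets borel) (hausdorff_outer s)"

subsection \<open>Lebesgue and Sobolev spaces\<close>

text \<open>Elements of these spaces are functions rather than classes modulo null sets; their values
  outside \<open>U\<close> are irrelevant.\<close>

definition Lp_space ::
    "real \<Rightarrow> 'a::euclidean_space set \<Rightarrow> ('a \<Rightarrow> 'b::euclidean_space) set" where
  "Lp_space p U = {g. g \<in> borel_measurable (lebesgue_on U) \<and>
     integrable (lebesgue_on U) (\<lambda>x. norm (g x) powr p)}"

definition Linf_space ::
    "'a::euclidean_space set \<Rightarrow> ('a \<Rightarrow> 'b::euclidean_space) set" where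
  "Linf_space U = {g. g \<in> borel_measurable (lebesgue_on U) \<and>
     (\<exists>M. AE x in lebesgue_on U. norm (g x) \<le> M)}"

definition test_function :: "'a::euclidean_space set \<Rightarrow> ('a \<Rightarrow> real) \<Rightarrow> bool" where
  "test_function U \<phi> \<longleftrightarrow>
     smooth_fun \<phi> \<and> compact (closure {x. \<phi> x \<noteq> 0}) \<and> closure {x. \<phi> x \<noteq> 0} \<subseteq> U"

text \<open>\<open>has_weak_gradient p U v g\<close>: the function \<open>v\<close> lies in \<open>W\<close> with exponents \<open>(1,p)\<close> on the open
  set \<open>U\<close>, and \<open>g\<close> represents its weak gradient (which is unique up to null sets).\<close>

definition has_weak_gradient ::
    "real \<Rightarrow> 'a::euclidean_space set \<Rightarrow> ('a \<Rightarrow> real) \<Rightarrow> ('a \<Rightarrow> 'a) \<Rightarrow> bool" where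
  "has_weak_gradient p U v g \<longleftrightarrow> v \<in> Lp_space p U \<and> g \<in> Lp_space p U \<and>
     (\<forall>\<phi>. test_function U \<phi> \<longrightarrow>
        (LINT x|lebesgue_on U. v x *\<^sub>R gradient \<phi> x) = - (LINT x|lebesgue_on U. \<phi> x *\<^sub>R g x))"

definition W1p_space :: "real \<Rightarrow> 'a::euclidean_space set \<Rightarrow> ('a \<Rightarrow> real) set" where
  "W1p_space p U = {v. \<exists>g. has_weak_gradient p U v g}"

text \<open>Trace on a relatively open part \<open>S\<close> of the Lipschitz boundary of \<open>\<Omega>\<close>, obtained by closing
  the restriction operator on smooth functions. It is localised to small balls, so that it makes
  sense for functions that are Sobolev only in a neighbourhood (relative to \<open>\<Omega>\<close>) of each point of
  \<open>S\<close>. In particular it applies to functions on \<open>\<Omega> - \<Gamma>\<close> if \<open>S\<close> is disjoint from the closed set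
  \<open>\<Gamma>\<close>.\<close>

definition has_trace ::
    "real \<Rightarrow> 'a::euclidean_space set \<Rightarrow> 'a set \<Rightarrow> ('a \<Rightarrow> real) \<Rightarrow> ('a \<Rightarrow> real) \<Rightarrow> bool" where
  "has_trace p \<Omega> S v h \<longleftrightarrow> h \<in> borel_measurable borel \<and>
     (\<forall>z\<in>S. \<exists>r>0. \<exists>g \<phi>. has_weak_gradient p (\<Omega> \<inter> ball z r) v g \<and> (\<forall>n::nat. smooth_fun (\<phi> n)) \<and>
        (\<lambda>n. \<integral>\<^sup>+x. ennreal (\<bar>\<phi> n x - v x\<bar> powr p) \<partial>lebesgue_on (\<Omega> \<inter> ball z r)) \<longlonglongrightarrow> 0 \<and>
        (\<lambda>n. \<integral>\<^sup>+x. ennreal (norm (gradient (\<phi> n) x - g x) powr p)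
                \<partial>lebesgue_on (\<Omega> \<inter> ball z r)) \<longlonglongrightarrow> 0 \<and>
        (\<lambda>n. \<integral>\<^sup>+x\<in>frontier \<Omega> \<inter> ball z r. ennreal (\<bar>\<phi> n x - h x\<bar> powr p)
                \<partial>hausdorff_measure (DIM('a) - 1)) \<longlonglongrightarrow> 0)"

text \<open>\<open>v = w\<close> on \<open>S\<close> in the sense of traces.\<close>

definition trace_eq ::
    "real \<Rightarrow> 'a::euclidean_space set \<Rightarrow> 'a set \<Rightarrow> ('a \<Rightarrow> real) \<Rightarrow> ('a \<Rightarrow> real) \<Rightarrow> bool" where
  "trace_eq p \<Omega> S v w \<longleftrightarrow> has_trace p \<Omega> S (\<lambda>x. v x - w x) (\<lambda>_. 0)"

subsection \<open>The crack problem\<close>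

text \<open>Here \<open>D\<close> is the Dirichlet part of the boundary and \<open>\<Gamma>\<close> the crack. Gradients of functions in
  \<open>W1p_space p (\<Omega> - \<Gamma>)\<close> are defined on \<open>\<Omega> - \<Gamma>\<close> only, so all integrals involving them are taken over
  \<open>\<Omega> - \<Gamma>\<close>; this is the integral over \<open>\<Omega>\<close> whenever \<open>\<Gamma>\<close> is Lebesgue-null.\<close>

definition admissible_variations ::
    "real \<Rightarrow> 'a::euclidean_space set \<Rightarrow> 'a set \<Rightarrow> 'a set \<Rightarrow> ('a \<Rightarrow> real) set" where
  "admissible_variations p \<Omega> D \<Gamma> = {v \<in> W1p_space p (\<Omega> - \<Gamma>). trace_eq p \<Omega> (D - \<Gamma>) v (\<lambda>_. 0)}"

text \<open>\<open>is_minimizer p f \<psi> \<Omega> D \<Gamma> u Du\<close>: the bounded function \<open>u\<close> solves the minimum problem with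
  crack \<open>\<Gamma>\<close>, and \<open>Du\<close> is its weak gradient.\<close>

definition is_minimizer ::
    "real \<Rightarrow> ('a \<Rightarrow> 'a \<Rightarrow> real) \<Rightarrow> ('a \<Rightarrow> real) \<Rightarrow> 'a::euclidean_space set \<Rightarrow> 'a set \<Rightarrow> 'a set \<Rightarrow>
     ('a \<Rightarrow> real) \<Rightarrow> ('a \<Rightarrow> 'a) \<Rightarrow> bool" where
  "is_minimizer p f \<psi> \<Omega> D \<Gamma> u Du \<longleftrightarrow>
     has_weak_gradient p (\<Omega> - \<Gamma>) u Du \<and> u \<in> Linf_space (\<Omega> - \<Gamma>) \<and>
     trace_eq p \<Omega> (D - \<Gamma>) u \<psi> \<and>
     (\<forall>v Dv. has_weak_gradient p (\<Omega> - \<Gamma>) v Dv \<longrightarrow> trace_eq p \<Omega> (D - \<Gamma>) v \<psi> \<longrightarrow>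
        (LINT x|lebesgue_on (\<Omega> - \<Gamma>). f x (Du x)) \<le> (LINT x|lebesgue_on (\<Omega> - \<Gamma>). f x (Dv x)))"

end

theory Submission
  imports Defs
begin

text \<open>
  For almost every \<open>x\<close> let \<open>F = f x\<close>, \<open>\<xi> = Du x\<close>, \<open>\<xi>' = Du\<Gamma> x\<close>, \<open>\<sigma> = \<nabla>F \<xi>\<close> and
  \<open>\<eta> = \<nabla>F\<^sup>* \<tau>\<close>. Since \<open>\<nabla>F\<close> and \<open>\<nabla>F\<^sup>*\<close> are inverse to each other, \<open>\<tau> = \<nabla>F \<eta>\<close> and
  \<open>\<xi> = \<nabla>F\<^sup>* \<sigma>\<close>. The tangent inequality for \<open>F\<close> at \<open>\<eta>\<close>, tested with \<open>\<xi>'\<close>, plus the tangent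
  inequality at \<open>\<xi>\<close>, tested with \<open>\<eta>\<close>, is
  \<open>F \<xi> - F \<xi>' \<le> (\<tau> - \<sigma>) \<bullet> (\<eta> - \<xi>) + \<tau> \<bullet> (\<xi> - \<xi>')\<close>
  (\<open>energy_difference_le\<close>). The last term integrates to zero, because \<open>u - u\<Gamma>\<close> is an admissible
  variation: the two functions have the same trace on \<open>D - \<Gamma>\<close> (\<open>trace_eq_diff\<close>). By monotonicity
  of \<open>\<nabla>F\<^sup>*\<close> the first term is nonnegative, so its integral does not decrease when the domain grows
  from \<open>\<Omega> - \<Gamma>\<close> to \<open>\<Omega>\<close>.

  The analytic content lies in giving a meaning to this computation. First, \<open>F\<^sup>*\<close> must be
  differentiable with \<open>\<nabla>F\<^sup>*\<close> inverse to \<open>\<nabla>F\<close>: coercivity and strict convexity make \<open>\<nabla>F\<close> a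
  continuous bijection whose inverse is locally bounded, hence continuous by compactness, and
  \<open>F\<^sup>*(\<zeta> + h) - F\<^sup>*(\<zeta>)\<close> is squeezed between the linear functions of \<open>h\<close> given by the two inverse
  images (\<open>conjugate_gderiv\<close>). Second, the right-hand side must be integrable. The growth of \<open>F\<close> gives
  \<open>norm (\<nabla>F \<xi>) powr q \<le> C * (norm \<xi> powr p + 1)\<close> and
  \<open>norm (\<nabla>F\<^sup>* \<zeta>) powr p \<le> C * norm \<zeta> powr q\<close>. Measurability of \<open>\<nabla>F\<^sup>*\<close> along \<open>\<tau>\<close> follows by
  writing \<open>F\<^sup>*\<close> as a limit of maxima over finite parts of a dense sequence, and its gradient as a
  limit of difference quotients; these limits exist only almost everywhere, which suffices because
  Lebesgue measure is complete.
\<close>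

section \<open>Duality for strictly convex functions of power growth\<close>

lemma gradient_eqI:
  assumes "GDERIV F x :> D"
  shows "gradient F x = D"
proof -
  have "D' = D" if "GDERIV F x :> D'" for D'
  proof -
    have "(\<lambda>h. h \<bullet> D') = (\<lambda>h. h \<bullet> D)"
      using that assms has_derivative_unique unfolding gderiv_def by blast
    then show ?thesis
      by (metis inner_commute vector_eq_rdot)
  qed
  with assms show ?thesis
    unfolding gradient_def by (intro the_equality)
qed

lemma GDERIV_gradient:
  fixes F :: "'a::euclidean_space \<Rightarrow> real"
  assumes "F differentiable at x"
  shows "GDERIV F x :> gradient F x"
proof -
  obtain L where L: "(F has_derivative L) (at x)"
    using assms by (auto simp: differentiable_def)
  then have "linear L"
    using has_derivative_linear by blast
  then have "L = (\<lambda>h. h \<bullet> adjoint L 1)"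
    by (simp add: adjoint_works)
  with L have "GDERIV F x :> adjoint L 1"
    by (simp add: gderiv_def)
  then show ?thesis
    using gradient_eqI by metis
qed

lemma GDERIV_along_line:
  fixes F :: "'a::euclidean_space \<Rightarrow> real"
  assumes "GDERIV F x :> D"
  shows "((\<lambda>t. F (x + t *\<^sub>R y)) has_field_derivative (D \<bullet> y)) (at 0)"
proof -
  have "((\<lambda>t. F (x + t *\<^sub>R y)) has_derivative (\<lambda>t. (t *\<^sub>R y) \<bullet> D)) (at 0)"
    by (rule has_derivative_compose[of "\<lambda>t. x + t *\<^sub>R y" "\<lambda>t. t *\<^sub>R y" 0 UNIV F "\<lambda>h. h \<bullet> D"])
       (use assms in \<open>auto simp: gderiv_def intro!: derivative_eq_intros\<close>)
  then show ?thesis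
    by (simp add: has_field_derivative_def inner_commute mult.commute[of "y \<bullet> D"] mult_commute_abs)
qed

text \<open>
  The restriction of \<open>F\<close> to the line through \<open>x\<close> and \<open>y\<close> is a convex function of one real
  variable, which lies above its tangents.
\<close>
lemma strictly_convex_above_tangent:
  fixes F :: "'a::euclidean_space \<Rightarrow> real"
  assumes sc: "strictly_convex F" and D: "GDERIV F x :> D"
  shows "F x + D \<bullet> (y - x) \<le> F y"
proof -
  let ?\<phi> = "\<lambda>t. F (x + t *\<^sub>R (y - x))"
  have "convex_on UNIV ?\<phi>"
  proof (rule convex_onI)
    fix t r s :: real
    assume t: "0 < t" "t < 1"
    let ?r = "x + r *\<^sub>R (y - x)" and ?s = "x + s *\<^sub>R (y - x)"
    have eq: "x + ((1 - t) *\<^sub>R r + t *\<^sub>R s) *\<^sub>R (y - x) = (1 - t) *\<^sub>R ?r + t *\<^sub>R ?s"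
      by (simp add: algebra_simps)
    show "?\<phi> ((1 - t) *\<^sub>R r + t *\<^sub>R s) \<le> (1 - t) * ?\<phi> r + t * ?\<phi> s"
    proof (cases "?r = ?s")
      case True
      show ?thesis
        unfolding eq True by (simp add: algebra_simps flip: scaleR_left_distrib)
    next
      case False
      then show ?thesis
        unfolding eq using sc t less_imp_le unfolding strictly_convex_def by blast
    qed
  qed auto
  from convex_on_imp_above_tangent[OF this, of 0 1 "D \<bullet> (y - x)"] GDERIV_along_line[OF D, of "y - x"]
  show ?thesis
    by simp
qed

text \<open>
  If the tangent at \<open>x\<close> met the graph at \<open>y\<close>, then at the midpoint the graph would lie below the
  chord, which there is part of the tangent.
\<close>
lemma strictly_convex_above_tangent_strict:
  fixes F :: "'a::euclidean_space \<Rightarrow> real"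
  assumes sc: "strictly_convex F" and D: "GDERIV F x :> D" and "x \<noteq> y"
  shows "F x + D \<bullet> (y - x) < F y"
proof -
  let ?m = "(1 - 1/2) *\<^sub>R x + (1/2::real) *\<^sub>R y"
  have "F ?m < (1 - 1/2) * F x + 1/2 * F y"
    using sc[unfolded strictly_convex_def, rule_format, OF \<open>x \<noteq> y\<close>, of "1/2"] by simp
  moreover have "F x + D \<bullet> (?m - x) \<le> F ?m"
    by (rule strictly_convex_above_tangent[OF sc D])
  moreover have "?m - x = (1/2) *\<^sub>R (y - x)"
    by (simp add: algebra_simps flip: scaleR_left_distrib)
  ultimately show ?thesis
    by simp
qed

text \<open>
  The sum is at most twice the maximum.
\<close>
lemma powr_add_le:
  fixes x y p :: real
  assumes "0 \<le> x" "0 \<le> y" "0 \<le> p"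
  shows "(x + y) powr p \<le> 2 powr p * (x powr p + y powr p)"
proof -
  have "(x + y) powr p \<le> (2 * max x y) powr p"
    using assms by (intro powr_mono2) auto
  also have "\<dots> = 2 powr p * max x y powr p"
    using assms by (simp add: powr_mult)
  also have "max x y powr p \<le> x powr p + y powr p"
    by (simp add: max_def)
  finally show ?thesis
    by simp
qed

text \<open>
  The properties that the integrand has as a function of the gradient at almost every point.
\<close>
locale convex_power_growth =
  fixes F :: "'a::euclidean_space \<Rightarrow> real" and a b p :: real
  assumes sc: "strictly_convex F" and C1: "C1_fun F" and F0: "F 0 = 0"
    and p: "1 < p" and a: "0 < a" and b: "0 < b"
    and lower: "\<And>\<xi>. a * norm \<xi> powr p \<le> F \<xi>"
    and upper: "\<And>\<xi>. F \<xi> \<le> b * (norm \<xi> powr p + 1)"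
begin

lemma gderiv: "GDERIV F \<xi> :> gradient F \<xi>"
  using C1 by (intro GDERIV_gradient) (auto simp: C1_fun_def)

lemma above_tangent: "F \<xi> + gradient F \<xi> \<bullet> (\<eta> - \<xi>) \<le> F \<eta>"
  by (rule strictly_convex_above_tangent[OF sc gderiv])

lemma continuous_F: "continuous_on A F"
  using C1 by (auto simp: C1_fun_def intro!: continuous_at_imp_continuous_on differentiable_imp_continuous_within)

text \<open>
  Two points with the same gradient would each lie strictly above the tangent at the other
  one.
\<close>
lemma inj_gradient: "inj (gradient F)"
proof (rule injI, rule ccontr)
  fix \<xi> \<eta> assume eq: "gradient F \<xi> = gradient F \<eta>" and "\<xi> \<noteq> \<eta>"
  then have "F \<xi> + gradient F \<xi> \<bullet> (\<eta> - \<xi>) < F \<eta>" "F \<eta> + gradient F \<xi> \<bullet> (\<xi> - \<eta>) < F \<xi>"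
    using strictly_convex_above_tangent_strict[OF sc gderiv] by metis+
  then show False
    by (simp add: inner_diff_right)
qed

text \<open>
  Dividing by \<open>norm \<xi>\<close> leaves a bound on \<open>norm \<xi> powr (p - 1)\<close>. The estimate serves twice: it
  confines the maximizers of \<open>\<zeta> \<bullet> \<xi> - F \<xi>\<close> to a ball, and it bounds the inverse of the
  gradient.
\<close>
lemma norm_le_if_coercive_le:
  assumes "a * norm \<xi> powr p \<le> norm \<zeta> * norm \<xi>"
  shows "norm \<xi> \<le> (norm \<zeta> / a) powr (1 / (p - 1))"
proof (cases "\<xi> = 0")
  case False
  have "norm \<xi> powr p = norm \<xi> powr (p - 1) * norm \<xi>"
    using False by (metis add.commute diff_add_cancel norm_eq_zero norm_ge_zero powr_mult_base mult.commute)
  with assms False have "norm \<xi> powr (p - 1) \<le> norm \<zeta> / a"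
    using a by (simp add: field_simps)
  then have "(norm \<xi> powr (p - 1)) powr (1 / (p - 1)) \<le> (norm \<zeta> / a) powr (1 / (p - 1))"
    using p by (intro powr_mono2) auto
  then show ?thesis
    using p by (simp add: powr_powr)
qed simp

lemma norm_le_gradient: "norm \<xi> \<le> (norm (gradient F \<xi>) / a) powr (1 / (p - 1))"
proof (rule norm_le_if_coercive_le)
  have "a * norm \<xi> powr p \<le> F \<xi>"
    by (rule lower)
  also have "\<dots> \<le> gradient F \<xi> \<bullet> \<xi>"
    using above_tangent[of \<xi> 0] F0 by simp
  also have "\<dots> \<le> norm (gradient F \<xi>) * norm \<xi>"
    by (rule norm_cauchy_schwarz)
  finally show "a * norm \<xi> powr p \<le> norm (gradient F \<xi>) * norm \<xi>" .
qed

text \<open>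
  By coercivity the continuous function \<open>\<zeta> \<bullet> \<xi> - F \<xi>\<close> of \<open>\<xi>\<close> attains its maximum on a ball,
  and this maximum is global; there its gradient \<open>\<zeta> - gradient F \<xi>\<close> vanishes.
\<close>
lemma surj_gradient: "\<exists>\<xi>. gradient F \<xi> = \<zeta>"
proof -
  define R where "R = (norm \<zeta> / a) powr (1 / (p - 1))"
  let ?H = "\<lambda>\<xi>. \<zeta> \<bullet> \<xi> - F \<xi>"
  have "continuous_on (cball 0 R) ?H"
    by (intro continuous_intros continuous_F)
  moreover have "cball 0 R \<noteq> ({} :: 'a set)"
    by (simp add: R_def)
  ultimately obtain \<xi> where \<xi>: "\<And>\<eta>. \<eta> \<in> cball 0 R \<Longrightarrow> ?H \<eta> \<le> ?H \<xi>"
    using continuous_attains_sup[of "cball 0 R" ?H] by (metis compact_cball)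
  have max: "?H \<eta> \<le> ?H \<xi>" for \<eta>
  proof (cases "\<eta> \<in> cball 0 R")
    case False
    then have "\<not> a * norm \<eta> powr p \<le> norm \<zeta> * norm \<eta>"
      using norm_le_if_coercive_le by (auto simp: R_def)
    then have "?H \<eta> \<le> 0"
      using lower[of \<eta>] norm_cauchy_schwarz[of \<zeta> \<eta>] by simp
    also have "0 \<le> ?H \<xi>"
      using \<xi>[of 0] F0 by (simp add: R_def)
    finally show ?thesis .
  qed (rule \<xi>)
  have "GDERIV (\<lambda>\<xi>. \<zeta> \<bullet> \<xi> - F \<xi>) \<xi> :> \<zeta> - gradient F \<xi>"
    by (rule GDERIV_diff[OF _ gderiv]) (auto simp: gderiv_def inner_commute intro!: derivative_eq_intros)
  then have "(\<lambda>h. h \<bullet> (\<zeta> - gradient F \<xi>)) = (\<lambda>h. 0)"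
    unfolding gderiv_def using max
    by (intro differential_zero_maxmin[where S = UNIV]) auto
  then have "(\<zeta> - gradient F \<xi>) \<bullet> (\<zeta> - gradient F \<xi>) = 0"
    by meson
  then have "gradient F \<xi> = \<zeta>"
    by simp
  then show ?thesis ..
qed

lemma maximizer:
  assumes "gradient F \<xi> = \<zeta>"
  shows "\<zeta> \<bullet> \<eta> - F \<eta> \<le> \<zeta> \<bullet> \<xi> - F \<xi>"
  using above_tangent[of \<xi> \<eta>] assms by (simp add: inner_diff_right)

lemma conjugate_bdd_above: "bdd_above (range (\<lambda>\<xi>. \<zeta> \<bullet> \<xi> - F \<xi>))"
proof -
  obtain \<xi> where "gradient F \<xi> = \<zeta>"
    using surj_gradient by blast
  from maximizer[OF this] show ?thesis
    by (intro bdd_aboveI2) auto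
qed

lemma conjugate_gradient: "convex_conjugate F (gradient F \<xi>) = gradient F \<xi> \<bullet> \<xi> - F \<xi>"
  unfolding convex_conjugate_def by (rule cSup_eq_maximum) (auto intro: maximizer)

text \<open>
  The inverse of a continuous injection on a compact set is continuous. The coercivity bound
  provides a closed ball whose image contains a neighbourhood of \<open>\<zeta>\<close>.
\<close>
lemma isCont_inv_gradient:
  "isCont (inv (gradient F)) \<zeta>"
proof -
  \<comment> \<open>The radius is the bound of \<open>norm_le_gradient\<close> for gradients of norm at most \<open>norm \<zeta> + 1\<close>.\<close>
  define K where "K = cball (0::'a) (((norm \<zeta> + 1) / a) powr (1 / (p - 1)))"
  have "continuous_on (gradient F ` K) (inv (gradient F))"
    using C1 inj_gradient unfolding K_def
    by (intro continuous_on_inv) (auto simp: C1_fun_def intro: continuous_on_subset)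
  moreover have "ball \<zeta> 1 \<subseteq> gradient F ` K"
  proof
    fix \<zeta>' assume "\<zeta>' \<in> ball \<zeta> 1"
    then have "norm \<zeta>' \<le> norm \<zeta> + 1"
      by (smt (verit, del_insts) dist_norm mem_ball norm_minus_commute norm_triangle_sub)
    moreover obtain \<xi> where \<xi>: "gradient F \<xi> = \<zeta>'"
      using surj_gradient by blast
    moreover have "(norm \<zeta>' / a) powr (1 / (p - 1)) \<le> ((norm \<zeta> + 1) / a) powr (1 / (p - 1))"
      using \<open>norm \<zeta>' \<le> norm \<zeta> + 1\<close> a p by (intro powr_mono2) (auto intro: divide_right_mono)
    ultimately have "\<xi> \<in> K"
      using norm_le_gradient[of \<xi>] by (simp add: K_def)
    with \<xi> show "\<zeta>' \<in> gradient F ` K"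
      by blast
  qed
  ultimately have "continuous_on (ball \<zeta> 1) (inv (gradient F))"
    using continuous_on_subset by blast
  then show ?thesis
    by (metis centre_in_ball continuous_on_eq_continuous_at open_ball zero_less_one)
qed

text \<open>
  Let \<open>G\<close> be the inverse of \<open>\<nabla>F\<close>. Then \<open>G \<zeta>\<close> is the maximizer in the definition of \<open>F\<^sup>* \<zeta>\<close>.
  Inserting the maximizer for \<open>\<zeta>\<close> into the supremum for \<open>\<zeta> + h\<close> and vice versa gives
  \<open>0 \<le> F\<^sup>* (\<zeta> + h) - F\<^sup>* \<zeta> - h \<bullet> G \<zeta> \<le> h \<bullet> (G (\<zeta> + h) - G \<zeta>)\<close>, and the right-hand side is \<open>o(h)\<close>
  by continuity of \<open>G\<close>.
\<close>
lemma conjugate_gderiv: "GDERIV (convex_conjugate F) (gradient F \<xi>) :> \<xi>"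
proof -
  let ?G = "inv (gradient F)" and ?\<zeta> = "gradient F \<xi>" and ?C = "convex_conjugate F"
  have G: "gradient F (?G \<zeta>) = \<zeta>" for \<zeta>
    using surj_gradient by (metis f_inv_into_f rangeI)
  have G\<xi>: "?G ?\<zeta> = \<xi>"
    by (simp add: inj_gradient)
  have C: "?C \<zeta> = \<zeta> \<bullet> ?G \<zeta> - F (?G \<zeta>)" for \<zeta>
    using conjugate_gradient[of "?G \<zeta>"] by (simp add: G)
  have bound: "norm (norm (?C (?\<zeta> + h) - ?C ?\<zeta> - h \<bullet> \<xi>) / norm h) \<le> norm (?G (?\<zeta> + h) - ?G ?\<zeta>)"
    for h
  proof -
    have "0 \<le> ?C (?\<zeta> + h) - ?C ?\<zeta> - h \<bullet> \<xi>"
      using maximizer[OF G, of "?\<zeta> + h" \<xi>] by (simp add: C G\<xi> inner_add_left)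
    moreover have "?C (?\<zeta> + h) - ?C ?\<zeta> - h \<bullet> \<xi> \<le> h \<bullet> (?G (?\<zeta> + h) - \<xi>)"
      using maximizer[OF refl, of \<xi> "?G (?\<zeta> + h)"] by (simp add: C G\<xi> inner_add_left inner_diff_right)
    moreover have "h \<bullet> (?G (?\<zeta> + h) - \<xi>) \<le> norm h * norm (?G (?\<zeta> + h) - \<xi>)"
      by (rule norm_cauchy_schwarz)
    ultimately show ?thesis
      by (cases "h = 0") (auto simp: G\<xi> divide_le_eq mult.commute)
  qed
  have "((\<lambda>h. ?G (?\<zeta> + h)) \<longlongrightarrow> ?G ?\<zeta>) (at 0)"
    using isCont_inv_gradient[of ?\<zeta>] by (simp add: isCont_iff)
  then have "((\<lambda>h. norm (?G (?\<zeta> + h) - ?G ?\<zeta>)) \<longlongrightarrow> 0) (at 0)"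
    by (intro tendsto_norm_zero) (simp add: LIM_zero)
  then have "((\<lambda>h. norm (?C (?\<zeta> + h) - ?C ?\<zeta> - h \<bullet> \<xi>) / norm h) \<longlongrightarrow> 0) (at 0)"
    by (rule Lim_null_comparison[rotated]) (use bound in \<open>auto intro: always_eventually\<close>)
  then show ?thesis
    unfolding gderiv_def has_derivative_at by (auto intro: bounded_linear_inner_left)
qed

lemma conjugate_differentiable: "convex_conjugate F differentiable at \<zeta>"
  using conjugate_gderiv surj_gradient by (metis differentiable_def gderiv_def)

lemma gradient_conjugate_gradient: "gradient (convex_conjugate F) (gradient F \<xi>) = \<xi>"
  by (rule gradient_eqI[OF conjugate_gderiv])

lemma gradient_gradient_conjugate: "gradient F (gradient (convex_conjugate F) \<zeta>) = \<zeta>"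
  using surj_gradient[of \<zeta>] gradient_conjugate_gradient by metis

lemma gradient_conjugate_growth:
  assumes "q = p / (p - 1)"
  shows "norm (gradient (convex_conjugate F) \<zeta>) powr p \<le> (1 / a) powr q * norm \<zeta> powr q"
proof -
  have "norm (gradient (convex_conjugate F) \<zeta>) powr p \<le> ((norm \<zeta> / a) powr (1 / (p - 1))) powr p"
    using norm_le_gradient[of "gradient (convex_conjugate F) \<zeta>"] p
    by (intro powr_mono2) (auto simp: gradient_gradient_conjugate)
  also have "\<dots> = (1 / a * norm \<zeta>) powr q"
    using p assms by (simp add: powr_powr)
  also have "\<dots> = (1 / a) powr q * norm \<zeta> powr q"
    using a by (subst powr_mult) auto
  finally show ?thesis .
qed

text \<open>
  With \<open>\<sigma> = \<nabla>F \<xi>\<close>, the tangent inequality at \<open>\<xi>\<close> is tested with the vector \<open>h\<close> in the direction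
  of \<open>\<sigma>\<close> of length \<open>2 * (norm \<xi> + 1)\<close>. This length is so large that \<open>\<sigma> \<bullet> h\<close> absorbs \<open>\<sigma> \<bullet> \<xi>\<close>,
  while \<open>F h\<close> is still of order \<open>(norm \<xi> + 1) powr p\<close>.
\<close>
lemma gradient_growth:
  assumes "q = p / (p - 1)"
  shows "norm (gradient F \<xi>) powr q \<le> (b * (2 powr p + 1)) powr q * 2 powr p * (norm \<xi> powr p + 1)"
proof -
  let ?\<sigma> = "gradient F \<xi>" and ?n = "norm \<xi> + 1"
  let ?C = "b * (2 powr p + 1)"
  define h where "h = (2 * ?n / norm ?\<sigma>) *\<^sub>R ?\<sigma>"
  have *: "norm ?\<sigma> \<le> ?C * ?n powr (p - 1)"
  proof (cases "?\<sigma> = 0")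
    case False
    have nh: "norm h = 2 * ?n"
      using False by (simp add: h_def)
    have "norm ?\<sigma> * ?n + norm ?\<sigma> * norm \<xi> \<le> 2 * ?n * norm ?\<sigma>"
      by (simp add: algebra_simps)
    also have "2 * ?n * norm ?\<sigma> = ?\<sigma> \<bullet> h"
      using False by (simp add: h_def dot_square_norm power2_eq_square)
    also have "?\<sigma> \<bullet> h = ?\<sigma> \<bullet> (h - \<xi>) + ?\<sigma> \<bullet> \<xi>"
      by (simp add: inner_diff_right)
    also have "?\<sigma> \<bullet> (h - \<xi>) \<le> F h"
    proof -
      have "0 \<le> F \<xi>"
        using lower[of \<xi>] a by (smt (verit) mult_nonneg_nonneg powr_ge_zero)
      then show ?thesis
        using above_tangent[of \<xi> h] by simp
    qed
    also have "?\<sigma> \<bullet> \<xi> \<le> norm ?\<sigma> * norm \<xi>"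
      by (rule norm_cauchy_schwarz)
    finally have "norm ?\<sigma> * ?n \<le> F h"
      by simp
    also have "F h \<le> b * (norm h powr p + 1)"
      by (rule upper)
    also have "norm h powr p + 1 \<le> (2 powr p + 1) * ?n powr p"
    proof -
      have "norm h powr p = 2 powr p * ?n powr p"
        unfolding nh by (subst powr_mult) auto
      moreover have "1 \<le> ?n powr p"
        using p by (simp add: ge_one_powr_ge_zero)
      ultimately show ?thesis
        by (simp add: distrib_right)
    qed
    also have "b * ((2 powr p + 1) * ?n powr p) = (?C * ?n powr (p - 1)) * ?n"
    proof -
      have "?n powr p = ?n powr (p - 1) * ?n"
        using powr_add[of ?n "p - 1" 1] by (simp add: add_nonneg_pos)
      then show ?thesis
        by (simp only: mult.assoc)
    qed
    finally have "norm ?\<sigma> * ?n \<le> (?C * ?n powr (p - 1)) * ?n"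
      using b by simp
    then show ?thesis
      by (simp add: add_nonneg_pos)
  qed (use b in auto)
  have "norm ?\<sigma> powr q \<le> (?C * ?n powr (p - 1)) powr q"
    using * p assms by (intro powr_mono2) auto
  also have "\<dots> = ?C powr q * (?n powr (p - 1)) powr q"
    using b by (subst powr_mult) auto
  also have "(?n powr (p - 1)) powr q = ?n powr p"
    using p assms by (simp add: powr_powr)
  also have "?n powr p \<le> 2 powr p * (norm \<xi> powr p + 1 powr p)"
    using p by (intro powr_add_le) auto
  finally show ?thesis
    by (simp add: mult.assoc mult_left_mono)
qed

text \<open>
  This is monotonicity of \<open>\<nabla>F\<close> between \<open>\<xi>\<close> and \<open>\<eta> = \<nabla>F\<^sup>* \<tau>\<close>.
\<close>
lemma gradient_conjugate_monotone:
  "0 \<le> (\<tau> - gradient F \<xi>) \<bullet> (gradient (convex_conjugate F) \<tau> - \<xi>)"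
proof -
  let ?\<eta> = "gradient (convex_conjugate F) \<tau>"
  have "F ?\<eta> + \<tau> \<bullet> (\<xi> - ?\<eta>) \<le> F \<xi>"
    using above_tangent[of ?\<eta> \<xi>] by (simp add: gradient_gradient_conjugate)
  with above_tangent[of \<xi> ?\<eta>] show ?thesis
    by (simp add: inner_diff_left inner_diff_right)
qed

text \<open>
  This is the sum of two tangent inequalities: at \<open>\<eta> = \<nabla>F\<^sup>* \<tau>\<close>, where the slope is \<open>\<tau>\<close>, tested
  with \<open>\<xi>'\<close>, and at \<open>\<xi>\<close>, tested with \<open>\<eta>\<close>.
\<close>
lemma energy_difference_le:
  "F \<xi> - F \<xi>' \<le> (\<tau> - gradient F \<xi>) \<bullet> (gradient (convex_conjugate F) \<tau> - \<xi>) + \<tau> \<bullet> (\<xi> - \<xi>')"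
proof -
  let ?\<eta> = "gradient (convex_conjugate F) \<tau>"
  have "F ?\<eta> + \<tau> \<bullet> (\<xi>' - ?\<eta>) \<le> F \<xi>'"
    using above_tangent[of ?\<eta> \<xi>'] by (simp add: gradient_gradient_conjugate)
  with above_tangent[of \<xi> ?\<eta>] show ?thesis
    by (simp add: inner_diff_left inner_diff_right)
qed

end

section \<open>Measurability of compositions\<close>

lemma (in complete_measure) borel_measurable_AE_eq:
  assumes f: "f \<in> borel_measurable M" and eq: "AE x in M. f x = g x"
  shows "g \<in> borel_measurable M"
proof (rule measurableI)
  fix A :: "'b set" assume A: "A \<in> sets borel"
  show "g -` A \<inter> space M \<in> sets M"
  proof (rule in_sets_AE)
    show "AE x in M. x \<in> f -` A \<inter> space M \<longleftrightarrow> x \<in> g -` A \<inter> space M"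
      using eq by eventually_elim auto
    show "f -` A \<inter> space M \<in> sets M"
      using f A by (rule measurable_sets)
  qed auto
qed auto

lemma (in complete_measure) borel_measurable_AE_LIMSEQ:
  fixes f :: "nat \<Rightarrow> 'a \<Rightarrow> 'b::{banach, second_countable_topology}"
  assumes "\<And>i. f i \<in> borel_measurable M" and lim: "AE x in M. (\<lambda>i. f i x) \<longlonglongrightarrow> g x"
  shows "g \<in> borel_measurable M"
proof (rule borel_measurable_AE_eq)
  show "(\<lambda>x. lim (\<lambda>i. f i x)) \<in> borel_measurable M"
    using assms(1) by measurable
  show "AE x in M. lim (\<lambda>i. f i x) = g x"
    using lim by eventually_elim (rule limI)
qed

text \<open>
  For a simple function \<open>w\<close> the composition is built from countably many of the measurable
  functions \<open>\<lambda>x. f x \<xi>\<close>. The general case follows by approximating \<open>w\<close> pointwise and using continuity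
  in \<open>\<xi>\<close>.
\<close>
lemma (in complete_measure) borel_measurable_Caratheodory_comp:
  fixes f :: "'a \<Rightarrow> 'b::euclidean_space \<Rightarrow> real" and w :: "'a \<Rightarrow> 'b"
  assumes f: "\<And>\<xi>. (\<lambda>x. f x \<xi>) \<in> borel_measurable M"
    and cont: "AE x in M. continuous_on UNIV (f x)" and w: "w \<in> borel_measurable M"
  shows "(\<lambda>x. f x (w x)) \<in> borel_measurable M"
proof -
  obtain s where s: "\<And>i. simple_function M (s i)" "\<And>x. x \<in> space M \<Longrightarrow> (\<lambda>i. s i x) \<longlonglongrightarrow> w x"
    using borel_measurable_implies_sequence_metric[OF w] by metis
  show ?thesis
  proof (rule borel_measurable_AE_LIMSEQ)
    fix i
    show "(\<lambda>x. f x (s i x)) \<in> borel_measurable M"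
    proof (rule measurable_compose_countable'[where f = "\<lambda>\<xi> x. f x \<xi>" and g = "s i" and I = "s i ` space M"])
      show "s i \<in> M \<rightarrow>\<^sub>M count_space (s i ` space M)"
        using s(1)[of i] by (auto simp: measurable_count_space_eq2 simple_function_def)
      show "countable (s i ` space M)"
        using s(1)[of i] by (simp add: simple_function_def countable_finite)
    qed (rule f)
  next
    show "AE x in M. (\<lambda>i. f x (s i x)) \<longlonglongrightarrow> f x (w x)"
      using cont AE_space
    proof eventually_elim
      case (elim x)
      then show ?case
        using s(2) by (auto intro!: isCont_tendsto_compose[of "w x" "f x"] simp: continuous_on_eq_continuous_at)
    qed
  qed
qed

text \<open>
  This replaces the supremum over all \<open>\<xi>\<close>, which is of no use for measurability, by a
  sequential limit of finite maxima.
\<close>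
lemma Max_dense_LIMSEQ_Sup:
  fixes H :: "'a::topological_space \<Rightarrow> real" and d :: "nat \<Rightarrow> 'a"
  assumes cont: "continuous_on UNIV H" and bdd: "bdd_above (range H)"
    and dense: "\<And>X. open X \<Longrightarrow> X \<noteq> {} \<Longrightarrow> \<exists>n. d n \<in> X"
  shows "(\<lambda>n. Max ((\<lambda>k. H (d k)) ` {..n})) \<longlonglongrightarrow> (SUP \<xi>. H \<xi>)"
proof (rule LIMSEQ_I)
  fix e :: real assume "0 < e"
  then obtain \<xi> where \<xi>: "(SUP \<xi>. H \<xi>) - e < H \<xi>"
    using bdd by (metis UNIV_I UNIV_not_empty diff_gt_0_iff_gt diff_less_eq less_add_same_cancel1 less_cSUP_iff)
  define X where "X = H -` {(SUP \<xi>. H \<xi>) - e<..}"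
  have "open X"
    using cont unfolding X_def by (intro open_vimage) auto
  moreover have "X \<noteq> {}"
    using \<xi> by (auto simp: X_def)
  ultimately obtain m where m: "d m \<in> X"
    using dense by blast
  have "norm (Max ((\<lambda>k. H (d k)) ` {..n}) - (SUP \<xi>. H \<xi>)) < e" if "m \<le> n" for n
  proof -
    have "H (d m) \<le> Max ((\<lambda>k. H (d k)) ` {..n})"
      using that by (intro Max_ge) auto
    moreover have "Max ((\<lambda>k. H (d k)) ` {..n}) \<le> (SUP \<xi>. H \<xi>)"
      using bdd by (subst Max_le_iff) (auto intro!: cSUP_upper)
    ultimately show ?thesis
      using m by (auto simp: X_def)
  qed
  then show "\<exists>m. \<forall>n\<ge>m. norm (Max ((\<lambda>k. H (d k)) ` {..n}) - (SUP \<xi>. H \<xi>)) < e"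
    by blast
qed

lemma (in complete_measure) borel_measurable_convex_conjugate:
  fixes f :: "'a \<Rightarrow> 'b::euclidean_space \<Rightarrow> real" and w :: "'a \<Rightarrow> 'b"
  assumes f: "\<And>\<xi>. (\<lambda>x. f x \<xi>) \<in> borel_measurable M"
    and cont: "AE x in M. continuous_on UNIV (f x)"
    and bdd: "AE x in M. bdd_above (range (\<lambda>\<xi>. w x \<bullet> \<xi> - f x \<xi>))"
    and w: "w \<in> borel_measurable M"
  shows "(\<lambda>x. convex_conjugate (f x) (w x)) \<in> borel_measurable M"
proof -
  obtain D :: "'b set" where D: "countable D" "\<And>X. open X \<Longrightarrow> X \<noteq> {} \<Longrightarrow> \<exists>d\<in>D. d \<in> X"
    by (erule countable_dense_setE)
  have "D \<noteq> {}"
    using D(2)[of UNIV] by auto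
  define d where "d = from_nat_into D"
  have dense: "\<exists>n. d n \<in> X" if "open X" "X \<noteq> {}" for X
    using D(2)[OF that] range_from_nat_into[OF \<open>D \<noteq> {}\<close> D(1)] unfolding d_def by (metis rangeE)
  show ?thesis
  proof (rule borel_measurable_AE_LIMSEQ)
    fix n :: nat
    show "(\<lambda>x. Max ((\<lambda>k. w x \<bullet> d k - f x (d k)) ` {..n})) \<in> borel_measurable M"
      using f w by (intro borel_measurable_Max) auto
  next
    show "AE x in M. (\<lambda>n. Max ((\<lambda>k. w x \<bullet> d k - f x (d k)) ` {..n})) \<longlonglongrightarrow> convex_conjugate (f x) (w x)"
      using cont bdd
    proof eventually_elim
      case (elim x)
      then show ?case
        unfolding convex_conjugate_def
        by (intro Max_dense_LIMSEQ_Sup[where H = "\<lambda>\<xi>. w x \<bullet> \<xi> - f x \<xi>"] dense continuous_intros)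
    qed
  qed
qed

text \<open>
  Each component of the gradient is a limit of difference quotients along \<open>1 / (n + 1)\<close>.
\<close>
lemma (in complete_measure) borel_measurable_gradient_comp:
  fixes h :: "'a \<Rightarrow> 'b::euclidean_space \<Rightarrow> real" and w :: "'a \<Rightarrow> 'b"
  assumes h: "\<And>e. (\<lambda>x. h x (w x + e)) \<in> borel_measurable M"
    and diff: "AE x in M. h x differentiable at (w x)"
  shows "(\<lambda>x. gradient (h x) (w x)) \<in> borel_measurable M"
  unfolding borel_measurable_euclidean_space[of "\<lambda>x. gradient (h x) (w x)"]
proof
  fix e :: 'b
  let ?t = "\<lambda>n. inverse (real (Suc n))"
  show "(\<lambda>x. gradient (h x) (w x) \<bullet> e) \<in> borel_measurable M"
  proof (rule borel_measurable_AE_LIMSEQ)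
    fix n
    show "(\<lambda>x. (h x (w x + ?t n *\<^sub>R e) - h x (w x)) / ?t n) \<in> borel_measurable M"
      using h[of "?t n *\<^sub>R e"] h[of 0] by simp
  next
    show "AE x in M. (\<lambda>n. (h x (w x + ?t n *\<^sub>R e) - h x (w x)) / ?t n) \<longlonglongrightarrow> gradient (h x) (w x) \<bullet> e"
      using diff
    proof eventually_elim
      case (elim x)
      have "((\<lambda>t. (h x (w x + t *\<^sub>R e) - h x (w x)) / t) \<longlongrightarrow> gradient (h x) (w x) \<bullet> e) (at 0)"
        using GDERIV_along_line[OF GDERIV_gradient[OF elim], of e] by (simp add: has_field_derivative_iff)
      moreover have "filterlim ?t (at 0) sequentially"
        using LIMSEQ_inverse_real_of_nat by (auto simp: filterlim_at simp del: of_nat_Suc intro!: always_eventually)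
      ultimately show ?case
        by (rule filterlim_compose)
    qed
  qed
qed

lemma complete_measure_lebesgue_on:
  assumes "S \<in> sets lebesgue"
  shows "complete_measure (lebesgue_on S)"
proof
  fix A B :: "'a set" assume "B \<subseteq> A" "A \<in> null_sets (lebesgue_on S)"
  then have "A \<subseteq> S" "A \<in> null_sets lebesgue"
    using assms by (auto simp: null_sets_restrict_space)
  with \<open>B \<subseteq> A\<close> have "B \<in> null_sets lebesgue"
    using null_sets_completion_subset by blast
  with \<open>A \<subseteq> S\<close> \<open>B \<subseteq> A\<close> assms show "B \<in> sets (lebesgue_on S)"
    by (auto simp: sets_restrict_space_iff)
qed

section \<open>Lebesgue spaces\<close>

lemma norm_diff_powr_le:
  fixes x y :: "'a::real_normed_vector"
  assumes "0 \<le> p"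
  shows "norm (x - y) powr p \<le> 2 powr p * (norm x powr p + norm y powr p)"
proof -
  have "norm (x - y) powr p \<le> (norm x + norm y) powr p"
    using assms by (intro powr_mono2 norm_triangle_ineq4) auto
  also have "\<dots> \<le> 2 powr p * (norm x powr p + norm y powr p)"
    using assms by (intro powr_add_le) auto
  finally show ?thesis .
qed

lemma Lp_space_diff:
  assumes "v \<in> Lp_space p U" "w \<in> Lp_space p U" "0 \<le> p"
  shows "(\<lambda>x. v x - w x) \<in> Lp_space p U"
proof -
  have [measurable]: "v \<in> borel_measurable (lebesgue_on U)" "w \<in> borel_measurable (lebesgue_on U)"
    using assms by (auto simp: Lp_space_def)
  have "integrable (lebesgue_on U) (\<lambda>x. norm (v x - w x) powr p)"
  proof (rule Bochner_Integration.integrable_bound)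
    show "integrable (lebesgue_on U) (\<lambda>x. 2 powr p * (norm (v x) powr p + norm (w x) powr p))"
      using assms by (auto simp: Lp_space_def)
    show "AE x in lebesgue_on U. norm (norm (v x - w x) powr p)
        \<le> norm (2 powr p * (norm (v x) powr p + norm (w x) powr p))"
      using norm_diff_powr_le[OF \<open>0 \<le> p\<close>] by auto
  qed measurable
  then show ?thesis
    by (simp add: Lp_space_def)
qed

lemma integrable_lebesgue_on_mono:
  fixes v :: "'a::euclidean_space \<Rightarrow> 'b::{banach, second_countable_topology}"
  assumes "integrable (lebesgue_on V) v" "U \<subseteq> V" "U \<in> sets lebesgue" "V \<in> sets lebesgue"
  shows "integrable (lebesgue_on U) v"
proof -
  have "integrable lebesgue (\<lambda>x. indicator U x *\<^sub>R indicator V x *\<^sub>R v x)"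
    using assms by (intro integrable_mult_indicator[of U lebesgue "\<lambda>x. indicator V x *\<^sub>R v x"])
      (auto simp: integrable_restrict_space)
  moreover have "(\<lambda>x. indicator U x *\<^sub>R indicator V x *\<^sub>R v x) = (\<lambda>x. indicator U x *\<^sub>R v x)"
    using assms(2) by (auto simp: indicator_def fun_eq_iff)
  ultimately show ?thesis
    using assms by (simp add: integrable_restrict_space)
qed

lemma Lp_space_mono:
  assumes "v \<in> Lp_space p V" "U \<subseteq> V" "U \<in> sets lebesgue" "V \<in> sets lebesgue"
  shows "v \<in> Lp_space p U"
  unfolding Lp_space_def
proof (intro CollectI conjI)
  show "v \<in> borel_measurable (lebesgue_on U)"
    using assms by (intro measurable_restrict_mono[OF _ \<open>U \<subseteq> V\<close>]) (simp add: Lp_space_def)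
  show "integrable (lebesgue_on U) (\<lambda>x. norm (v x) powr p)"
    using assms by (intro integrable_lebesgue_on_mono[OF _ assms(2-4)]) (simp add: Lp_space_def)
qed

lemma Lp_space_integrable:
  assumes "v \<in> Lp_space p U" "1 \<le> p" "bounded U" "U \<in> sets lebesgue"
  shows "integrable (lebesgue_on U) v"
proof (rule Bochner_Integration.integrable_bound)
  interpret finite_measure "lebesgue_on U"
    using assms by (intro finite_measure_lebesgue_on bounded_set_imp_lmeasurable)
  show "integrable (lebesgue_on U) (\<lambda>x. 1 + norm (v x) powr p)"
    using assms by (auto simp: Lp_space_def)
  have "norm (v x) \<le> 1 + norm (v x) powr p" for x
  proof (cases "norm (v x) \<le> 1")
    case False
    then have "norm (v x) powr 1 \<le> norm (v x) powr p"
      using assms by (intro powr_mono) auto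
    then show ?thesis
      by simp
  qed (simp add: add_increasing2)
  then show "AE x in lebesgue_on U. norm (v x) \<le> norm (1 + norm (v x) powr p)"
    by (auto intro: order_trans)
  show "v \<in> borel_measurable (lebesgue_on U)"
    using assms by (simp add: Lp_space_def)
qed

lemma integrable_inner_Lp_space:
  fixes v w :: "'a::euclidean_space \<Rightarrow> 'b::euclidean_space"
  assumes "v \<in> Lp_space q U" "w \<in> Lp_space p U" "1 < p" "q = p / (p - 1)"
  shows "integrable (lebesgue_on U) (\<lambda>x. v x \<bullet> w x)"
proof (rule Bochner_Integration.integrable_bound)
  have "1 < q"
    using assms by (simp add: less_divide_eq)
  have "1 / q + 1 / p = 1"
    using assms by (simp add: diff_divide_distrib)
  show "integrable (lebesgue_on U) (\<lambda>x. norm (v x) powr q / q + norm (w x) powr p / p)"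
    using assms by (auto simp: Lp_space_def)
  have "norm (v x \<bullet> w x) \<le> norm (v x) powr q / q + norm (w x) powr p / p" for x
    using Cauchy_Schwarz_ineq2[of "v x" "w x"]
      Youngs_inequality[OF \<open>1 < q\<close> \<open>1 < p\<close> \<open>1 / q + 1 / p = 1\<close>, of "norm (v x)" "norm (w x)"] by simp
  then show "AE x in lebesgue_on U. norm (v x \<bullet> w x) \<le> norm (norm (v x) powr q / q + norm (w x) powr p / p)"
    unfolding real_norm_def by (intro AE_I2 order_trans[OF _ abs_ge_self])
  show "(\<lambda>x. v x \<bullet> w x) \<in> borel_measurable (lebesgue_on U)"
    using assms by (auto simp: Lp_space_def)
qed

text \<open>
  On a bounded set the additive constant is integrable.
\<close>
lemma Lp_space_growth:
  assumes "w \<in> Lp_space r U" "v \<in> borel_measurable (lebesgue_on U)"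
    and "bounded U" "U \<in> sets lebesgue"
    and le: "AE x in lebesgue_on U. norm (v x) powr s \<le> C * norm (w x) powr r + c"
  shows "v \<in> Lp_space s U"
proof -
  interpret finite_measure "lebesgue_on U"
    using assms by (intro finite_measure_lebesgue_on bounded_set_imp_lmeasurable)
  have "integrable (lebesgue_on U) (\<lambda>x. norm (v x) powr s)"
  proof (rule Bochner_Integration.integrable_bound)
    show "integrable (lebesgue_on U) (\<lambda>x. C * norm (w x) powr r + c)"
      using assms by (auto simp: Lp_space_def)
    show "AE x in lebesgue_on U. norm (norm (v x) powr s) \<le> norm (C * norm (w x) powr r + c)"
      using le by eventually_elim simp
  qed (use assms in measurable)
  with assms show ?thesis
    by (simp add: Lp_space_def)
qed

section \<open>Weak gradients and traces of differences\<close>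

lemma gradient_diff:
  fixes F G :: "'a::euclidean_space \<Rightarrow> real"
  assumes "F differentiable at x" "G differentiable at x"
  shows "gradient (\<lambda>x. F x - G x) x = gradient F x - gradient G x"
  by (rule gradient_eqI[OF GDERIV_diff]) (intro GDERIV_gradient assms)+

lemma Ck_fun_diff: "Ck_fun k F \<Longrightarrow> Ck_fun k G \<Longrightarrow> Ck_fun k (\<lambda>x. F x - G x)"
proof (induction k arbitrary: F G)
  case 0
  then show ?case
    by (auto intro: continuous_intros)
next
  case (Suc k)
  then show ?case
    by (auto simp: gradient_diff inner_diff_left)
qed

lemma smooth_fun_diff: "smooth_fun F \<Longrightarrow> smooth_fun G \<Longrightarrow> smooth_fun (\<lambda>x. F x - G x)"
  by (simp add: smooth_fun_def Ck_fun_diff)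

lemma smooth_fun_differentiable: "smooth_fun F \<Longrightarrow> F differentiable at x"
  unfolding smooth_fun_def using Ck_fun.simps(2)[of 0 F] by blast

lemma smooth_fun_continuous: "smooth_fun F \<Longrightarrow> continuous_on A F"
  unfolding smooth_fun_def using Ck_fun.simps(1)[of F] continuous_on_subset by blast

lemma smooth_fun_gradient_continuous:
  assumes "smooth_fun F"
  shows "continuous_on A (gradient F)"
proof -
  have "Ck_fun (Suc 0) F"
    using assms by (simp add: smooth_fun_def del: Ck_fun.simps)
  then have "continuous_on UNIV (\<lambda>x. gradient F x \<bullet> e)" if "e \<in> Basis" for e
    using that by simp
  then have "continuous_on UNIV (gradient F)"
    by (rule continuous_on_componentwise[THEN iffD2, rule_format])
  then show ?thesis
    using continuous_on_subset by blast
qed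

lemma gradient_outside_support:
  assumes "x \<notin> closure {x. \<phi> x \<noteq> 0}"
  shows "gradient \<phi> x = 0"
proof (rule gradient_eqI)
  let ?V = "- closure {x. \<phi> x \<noteq> 0}"
  have "(\<phi> has_derivative (\<lambda>h. 0)) (at x)"
  proof (rule has_derivative_transform_within_open[of "\<lambda>_. 0" _ x UNIV ?V])
    show "0 = \<phi> y" if "y \<in> ?V" for y
      using that closure_subset[of "{x. \<phi> x \<noteq> 0}"] by auto
    show "open ?V"
      by (rule open_Compl[OF closed_closure])
  qed (use assms in simp_all)
  then show "GDERIV \<phi> x :> 0"
    by (simp add: gderiv_def)
qed

text \<open>
  A test function on the smaller set is one on the larger set, and both integrands vanish outside
  its support.
\<close>
lemma has_weak_gradient_mono:
  fixes U V :: "'a::euclidean_space set"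
  assumes "has_weak_gradient p V v g" "U \<subseteq> V" "U \<in> sets lebesgue" "V \<in> sets lebesgue"
  shows "has_weak_gradient p U v g"
proof -
  have "(LINT x|lebesgue_on U. v x *\<^sub>R gradient \<phi> x) = - (LINT x|lebesgue_on U. \<phi> x *\<^sub>R g x)"
    if \<phi>: "test_function U \<phi>" for \<phi>
  proof -
    have zero: "\<phi> x = 0" "gradient \<phi> x = 0" if "x \<notin> U" for x
    proof -
      have "x \<notin> closure {x. \<phi> x \<noteq> 0}"
        using \<phi> that by (auto simp: test_function_def)
      then show "\<phi> x = 0" "gradient \<phi> x = 0"
        using closure_subset[of "{x. \<phi> x \<noteq> 0}"] by (auto intro: gradient_outside_support)
    qed
    have "(LINT x|lebesgue_on U. v x *\<^sub>R gradient \<phi> x) = (LINT x|lebesgue_on V. v x *\<^sub>R gradient \<phi> x)"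
      using assms zero by (subst integral_restrict[symmetric, OF assms(2-4)]) (auto intro!: Bochner_Integration.integral_cong)
    also have "\<dots> = - (LINT x|lebesgue_on V. \<phi> x *\<^sub>R g x)"
      using assms \<phi> by (auto simp: has_weak_gradient_def test_function_def)
    also have "(LINT x|lebesgue_on V. \<phi> x *\<^sub>R g x) = (LINT x|lebesgue_on U. \<phi> x *\<^sub>R g x)"
      using assms zero by (subst integral_restrict[symmetric, OF assms(2-4)]) (auto intro!: Bochner_Integration.integral_cong)
    finally show ?thesis .
  qed
  with assms(1) show ?thesis
    by (auto simp: has_weak_gradient_def intro: Lp_space_mono[OF _ assms(2-4)])
qed

text \<open>
  On a bounded set functions in the Lebesgue space with exponent \<open>p\<close> are integrable. A test function
  and its gradient are bounded, so all integrals involved are finite and additive.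
\<close>
lemma has_weak_gradient_diff:
  fixes U :: "'a::euclidean_space set"
  assumes v: "has_weak_gradient p U v g" and w: "has_weak_gradient p U w h"
    and "1 \<le> p" "bounded U" "U \<in> sets lebesgue"
  shows "has_weak_gradient p U (\<lambda>x. v x - w x) (\<lambda>x. g x - h x)"
proof -
  have int: "integrable (lebesgue_on U) v" "integrable (lebesgue_on U) w"
    "integrable (lebesgue_on U) g" "integrable (lebesgue_on U) h"
    using v w by (auto simp: has_weak_gradient_def intro: Lp_space_integrable[OF _ assms(3-5)])
  have "(LINT x|lebesgue_on U. (v x - w x) *\<^sub>R gradient \<phi> x) = - (LINT x|lebesgue_on U. \<phi> x *\<^sub>R (g x - h x))"
    if \<phi>: "test_function U \<phi>" for \<phi>
  proof -
    let ?K = "closure {x. \<phi> x \<noteq> 0}"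
    have sm: "smooth_fun \<phi>" and K: "compact ?K"
      using \<phi> by (auto simp: test_function_def)
    have "bounded (\<phi> ` ?K)" "bounded (gradient \<phi> ` ?K)"
      using compact_continuous_image[OF smooth_fun_continuous[OF sm] K]
        compact_continuous_image[OF smooth_fun_gradient_continuous[OF sm] K] by (auto intro: compact_imp_bounded)
    then obtain B1 B2 where B: "\<And>x. x \<in> ?K \<Longrightarrow> norm (\<phi> x) \<le> B1" "\<And>x. x \<in> ?K \<Longrightarrow> norm (gradient \<phi> x) \<le> B2"
      by (auto simp: bounded_iff)
    have B1: "norm (\<phi> x) \<le> \<bar>B1\<bar>" for x
      using B(1)[of x] closure_subset[of "{x. \<phi> x \<noteq> 0}"] by (cases "\<phi> x = 0") auto
    have B2: "norm (gradient \<phi> x) \<le> \<bar>B2\<bar>" for x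
      using B(2)[of x] gradient_outside_support[of x \<phi>] by (cases "x \<in> ?K") auto
    have meas: "\<phi> \<in> borel_measurable (lebesgue_on U)" "gradient \<phi> \<in> borel_measurable (lebesgue_on U)"
      using assms smooth_fun_continuous[OF sm] smooth_fun_gradient_continuous[OF sm]
      by (auto intro: continuous_imp_measurable_on_sets_lebesgue)
    have i1: "integrable (lebesgue_on U) (\<lambda>x. k x *\<^sub>R gradient \<phi> x)" if "integrable (lebesgue_on U) k" for k
    proof (rule Bochner_Integration.integrable_bound)
      show "integrable (lebesgue_on U) (\<lambda>x. k x * \<bar>B2\<bar>)"
        using that by simp
      show "AE x in lebesgue_on U. norm (k x *\<^sub>R gradient \<phi> x) \<le> norm (k x * \<bar>B2\<bar>)"
        using B2 by (auto simp: abs_mult intro!: mult_left_mono)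
      show "(\<lambda>x. k x *\<^sub>R gradient \<phi> x) \<in> borel_measurable (lebesgue_on U)"
        using that meas by auto
    qed
    have i2: "integrable (lebesgue_on U) (\<lambda>x. \<phi> x *\<^sub>R k x)" if "integrable (lebesgue_on U) k" for k :: "'a \<Rightarrow> 'a"
    proof (rule Bochner_Integration.integrable_bound)
      show "integrable (lebesgue_on U) (\<lambda>x. \<bar>B1\<bar> *\<^sub>R k x)"
        using that by simp
      show "AE x in lebesgue_on U. norm (\<phi> x *\<^sub>R k x) \<le> norm (\<bar>B1\<bar> *\<^sub>R k x)"
        using B1 by (auto intro!: mult_right_mono)
      show "(\<lambda>x. \<phi> x *\<^sub>R k x) \<in> borel_measurable (lebesgue_on U)"
        using that meas by auto
    qed
    show ?thesis
      using v w \<phi> int by (simp add: scaleR_diff_left scaleR_diff_right i1 i2 has_weak_gradient_def)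
  qed
  with assms show ?thesis
    by (simp add: has_weak_gradient_def Lp_space_diff)
qed

text \<open>
  The integrand is at most \<open>2 powr p\<close> times the sum of the two given ones. With target type
  \<open>real\<close> or \<open>'a\<close> and a volume or surface measure this covers all three limits that define a trace.
\<close>
lemma nn_integral_powr_diff_LIMSEQ_0:
  fixes F G :: "nat \<Rightarrow> 'a \<Rightarrow> 'b::euclidean_space"
  assumes [measurable]: "\<And>n. F n \<in> borel_measurable M" "\<And>n. G n \<in> borel_measurable M"
    and "0 \<le> p"
    and F: "(\<lambda>n. \<integral>\<^sup>+x. ennreal (norm (F n x) powr p) \<partial>M) \<longlonglongrightarrow> 0"
    and G: "(\<lambda>n. \<integral>\<^sup>+x. ennreal (norm (G n x) powr p) \<partial>M) \<longlonglongrightarrow> 0"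
  shows "(\<lambda>n. \<integral>\<^sup>+x. ennreal (norm (F n x - G n x) powr p) \<partial>M) \<longlonglongrightarrow> 0"
proof -
  let ?h = "\<lambda>n. ennreal (2 powr p) *
    ((\<integral>\<^sup>+x. ennreal (norm (F n x) powr p) \<partial>M) + (\<integral>\<^sup>+x. ennreal (norm (G n x) powr p) \<partial>M))"
  have le: "(\<integral>\<^sup>+x. ennreal (norm (F n x - G n x) powr p) \<partial>M) \<le> ?h n" for n
  proof -
    have "(\<integral>\<^sup>+x. ennreal (norm (F n x - G n x) powr p) \<partial>M)
        \<le> (\<integral>\<^sup>+x. ennreal (2 powr p) * (ennreal (norm (F n x) powr p) + ennreal (norm (G n x) powr p)) \<partial>M)"
      by (intro nn_integral_mono)
         (simp add: norm_diff_powr_le[OF \<open>0 \<le> p\<close>] flip: ennreal_plus ennreal_mult)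
    also have "\<dots> = ?h n"
      by (subst nn_integral_cmult, measurable) (subst nn_integral_add, auto)
    finally show ?thesis .
  qed
  have "?h \<longlonglongrightarrow> ennreal (2 powr p) * (0 + 0)"
    using F G by (intro ennreal_tendsto_cmult tendsto_add) auto
  then have "?h \<longlonglongrightarrow> 0"
    by simp
  from tendsto_sandwich[OF _ _ tendsto_const this] le show ?thesis
    by (simp add: always_eventually)
qed

lemma nn_integral_restrict_LIMSEQ_0_mono:
  fixes F :: "nat \<Rightarrow> 'a \<Rightarrow> ennreal"
  assumes F: "(\<lambda>n. \<integral>\<^sup>+x. F n x \<partial>restrict_space M V) \<longlonglongrightarrow> 0"
    and "U \<subseteq> V" "U \<inter> space M \<in> sets M" "V \<inter> space M \<in> sets M"
  shows "(\<lambda>n. \<integral>\<^sup>+x. F n x \<partial>restrict_space M U) \<longlonglongrightarrow> 0"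
proof (rule tendsto_sandwich[OF _ _ tendsto_const F])
  show "\<forall>\<^sub>F n in sequentially. (\<integral>\<^sup>+x. F n x \<partial>restrict_space M U) \<le> (\<integral>\<^sup>+x. F n x \<partial>restrict_space M V)"
    using assms by (auto simp: nn_integral_restrict_space indicator_def intro!: always_eventually nn_integral_mono)
qed auto

lemma sets_hausdorff_measure: "sets (hausdorff_measure s) = sets borel"
  unfolding hausdorff_measure_def by (metis sets.sets_measure_of_eq space_borel)

lemma space_hausdorff_measure: "space (hausdorff_measure s) = UNIV"
  unfolding hausdorff_measure_def by (simp add: space_measure_of_conv)

text \<open>
  Near a point of \<open>S \<inter> T\<close> both traces are witnessed on balls, possibly of different radii. On the
  smaller ball the differences of the approximating smooth functions approximate \<open>v - w\<close>, its gradient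
  and its boundary values.
\<close>
lemma has_trace_diff:
  fixes \<Omega> S T :: "'a::euclidean_space set"
  assumes v: "has_trace p \<Omega> S v h" and w: "has_trace p \<Omega> T w k"
    and "1 \<le> p" "open \<Omega>"
  shows "has_trace p \<Omega> (S \<inter> T) (\<lambda>x. v x - w x) (\<lambda>x. h x - k x)"
  unfolding has_trace_def
proof (intro conjI ballI)
  have hk[measurable]: "h \<in> borel_measurable borel" "k \<in> borel_measurable borel"
    using v w by (auto simp: has_trace_def)
  then show "(\<lambda>x. h x - k x) \<in> borel_measurable borel"
    by measurable
  fix z assume "z \<in> S \<inter> T"
  then have "z \<in> S" "z \<in> T"
    by auto
  let ?H = "hausdorff_measure (DIM('a) - 1) :: 'a measure"
  obtain r g \<phi> where r: "0 < r" and g: "has_weak_gradient p (\<Omega> \<inter> ball z r) v g"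
    and \<phi>: "\<And>n::nat. smooth_fun (\<phi> n)"
    and \<phi>v: "(\<lambda>n. \<integral>\<^sup>+x. ennreal (\<bar>\<phi> n x - v x\<bar> powr p) \<partial>lebesgue_on (\<Omega> \<inter> ball z r)) \<longlonglongrightarrow> 0"
    and \<phi>g: "(\<lambda>n. \<integral>\<^sup>+x. ennreal (norm (gradient (\<phi> n) x - g x) powr p) \<partial>lebesgue_on (\<Omega> \<inter> ball z r)) \<longlonglongrightarrow> 0"
    and \<phi>h: "(\<lambda>n. \<integral>\<^sup>+x\<in>frontier \<Omega> \<inter> ball z r. ennreal (\<bar>\<phi> n x - h x\<bar> powr p) \<partial>?H) \<longlonglongrightarrow> 0"
    using v \<open>z \<in> S\<close> unfolding has_trace_def by blast
  obtain r' g' \<phi>' where r': "0 < r'" and g': "has_weak_gradient p (\<Omega> \<inter> ball z r') w g'"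
    and \<phi>': "\<And>n::nat. smooth_fun (\<phi>' n)"
    and \<phi>w: "(\<lambda>n. \<integral>\<^sup>+x. ennreal (\<bar>\<phi>' n x - w x\<bar> powr p) \<partial>lebesgue_on (\<Omega> \<inter> ball z r')) \<longlonglongrightarrow> 0"
    and \<phi>g': "(\<lambda>n. \<integral>\<^sup>+x. ennreal (norm (gradient (\<phi>' n) x - g' x) powr p) \<partial>lebesgue_on (\<Omega> \<inter> ball z r')) \<longlonglongrightarrow> 0"
    and \<phi>k: "(\<lambda>n. \<integral>\<^sup>+x\<in>frontier \<Omega> \<inter> ball z r'. ennreal (\<bar>\<phi>' n x - k x\<bar> powr p) \<partial>?H) \<longlonglongrightarrow> 0"
    using w \<open>z \<in> T\<close> unfolding has_trace_def by blast
  define \<rho> where "\<rho> = min r r'"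
  define B where "B = \<Omega> \<inter> ball z \<rho>"
  define E where "E = frontier \<Omega> \<inter> ball z \<rho>"
  have B: "B \<in> sets lebesgue" "B \<subseteq> \<Omega> \<inter> ball z r" "B \<subseteq> \<Omega> \<inter> ball z r'" "bounded B"
    using \<open>open \<Omega>\<close> by (auto simp: B_def \<rho>_def intro: borel_open bounded_subset[OF bounded_ball])
  have ball: "\<Omega> \<inter> ball z s \<in> sets lebesgue" for s
    using \<open>open \<Omega>\<close> by (auto intro: borel_open)
  have E: "frontier \<Omega> \<inter> ball z s \<in> sets ?H" for s
    by (auto simp: sets_hausdorff_measure)
  have restr: "(\<integral>\<^sup>+x\<in>frontier \<Omega> \<inter> ball z s. c x \<partial>?H) = (\<integral>\<^sup>+x. c x \<partial>restrict_space ?H (frontier \<Omega> \<inter> ball z s))"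
    for c s
    using E[of s] by (simp only: nn_integral_restrict_space space_hausdorff_measure Int_UNIV_right)
  have subE: "E \<subseteq> frontier \<Omega> \<inter> ball z r" "E \<subseteq> frontier \<Omega> \<inter> ball z r'"
    by (auto simp: E_def \<rho>_def)
  have sE: "E \<inter> space ?H \<in> sets ?H" "(frontier \<Omega> \<inter> ball z s) \<inter> space ?H \<in> sets ?H" for s
    using E unfolding E_def space_hausdorff_measure Int_UNIV_right by blast+
  have wg: "has_weak_gradient p B v g" "has_weak_gradient p B w g'"
    using has_weak_gradient_mono g g' B ball by blast+
  have mB: "c \<in> borel_measurable (lebesgue_on B)" if "continuous_on UNIV c" for c :: "'a \<Rightarrow> 'b::euclidean_space"
    using that B by (intro continuous_imp_measurable_on_sets_lebesgue) (auto intro: continuous_on_subset)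
  have mE: "c \<in> borel_measurable (restrict_space ?H E)" if "c \<in> borel_measurable borel" for c :: "'a \<Rightarrow> real"
    using that by (intro measurable_restrict_space1) (simp add: measurable_cong_sets[OF sets_hausdorff_measure])
  have [measurable]: "\<phi> n \<in> borel_measurable (lebesgue_on B)" "\<phi>' n \<in> borel_measurable (lebesgue_on B)"
    "gradient (\<phi> n) \<in> borel_measurable (lebesgue_on B)" "gradient (\<phi>' n) \<in> borel_measurable (lebesgue_on B)"
    "v \<in> borel_measurable (lebesgue_on B)" "w \<in> borel_measurable (lebesgue_on B)"
    "g \<in> borel_measurable (lebesgue_on B)" "g' \<in> borel_measurable (lebesgue_on B)"
    "\<phi> n \<in> borel_measurable borel" "\<phi>' n \<in> borel_measurable borel" for n
    using wg \<phi>[of n] \<phi>'[of n]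
    by (auto intro!: mB borel_measurable_continuous_onI smooth_fun_continuous smooth_fun_gradient_continuous
        simp: has_weak_gradient_def Lp_space_def)
  have eq1: "\<phi> n x - \<phi>' n x - (v x - w x) = \<phi> n x - v x - (\<phi>' n x - w x)" for n x
    by simp
  have eq2: "gradient (\<lambda>x. \<phi> n x - \<phi>' n x) x - (g x - g' x) = gradient (\<phi> n) x - g x - (gradient (\<phi>' n) x - g' x)" for n x
    using \<phi>[of n] \<phi>'[of n] by (simp add: gradient_diff smooth_fun_differentiable)
  have eq3: "\<phi> n x - \<phi>' n x - (h x - k x) = \<phi> n x - h x - (\<phi>' n x - k x)" for n x
    by simp
  show "\<exists>r>0. \<exists>g \<psi>. has_weak_gradient p (\<Omega> \<inter> ball z r) (\<lambda>x. v x - w x) g \<and> (\<forall>n::nat. smooth_fun (\<psi> n)) \<and>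
      (\<lambda>n. \<integral>\<^sup>+x. ennreal (\<bar>\<psi> n x - (v x - w x)\<bar> powr p) \<partial>lebesgue_on (\<Omega> \<inter> ball z r)) \<longlonglongrightarrow> 0 \<and>
      (\<lambda>n. \<integral>\<^sup>+x. ennreal (norm (gradient (\<psi> n) x - g x) powr p) \<partial>lebesgue_on (\<Omega> \<inter> ball z r)) \<longlonglongrightarrow> 0 \<and>
      (\<lambda>n. \<integral>\<^sup>+x\<in>frontier \<Omega> \<inter> ball z r. ennreal (\<bar>\<psi> n x - (h x - k x)\<bar> powr p) \<partial>?H) \<longlonglongrightarrow> 0"
  proof (intro exI conjI allI)
    show "0 < \<rho>"
      using r r' by (simp add: \<rho>_def)
    show "has_weak_gradient p (\<Omega> \<inter> ball z \<rho>) (\<lambda>x. v x - w x) (\<lambda>x. g x - g' x)"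
      using has_weak_gradient_diff[OF wg \<open>1 \<le> p\<close> \<open>bounded B\<close>] B by (simp add: B_def)
    show "smooth_fun (\<lambda>x. \<phi> n x - \<phi>' n x)" for n
      using \<phi> \<phi>' by (rule smooth_fun_diff)
    have "(\<lambda>n. \<integral>\<^sup>+x. ennreal (norm (\<phi> n x - v x - (\<phi>' n x - w x)) powr p) \<partial>lebesgue_on B) \<longlonglongrightarrow> 0"
    proof (rule nn_integral_powr_diff_LIMSEQ_0)
      show "(\<lambda>n. \<integral>\<^sup>+x. ennreal (norm (\<phi> n x - v x) powr p) \<partial>lebesgue_on B) \<longlonglongrightarrow> 0"
        using \<phi>v B ball by (intro nn_integral_restrict_LIMSEQ_0_mono[OF _ B(2)]) auto
      show "(\<lambda>n. \<integral>\<^sup>+x. ennreal (norm (\<phi>' n x - w x) powr p) \<partial>lebesgue_on B) \<longlonglongrightarrow> 0"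
        using \<phi>w B ball by (intro nn_integral_restrict_LIMSEQ_0_mono[OF _ B(3)]) auto
    qed (use \<open>1 \<le> p\<close> in auto)
    then show "(\<lambda>n. \<integral>\<^sup>+x. ennreal (\<bar>\<phi> n x - \<phi>' n x - (v x - w x)\<bar> powr p) \<partial>lebesgue_on (\<Omega> \<inter> ball z \<rho>)) \<longlonglongrightarrow> 0"
      unfolding eq1 by (simp add: B_def)
    have "(\<lambda>n. \<integral>\<^sup>+x. ennreal (norm (gradient (\<phi> n) x - g x - (gradient (\<phi>' n) x - g' x)) powr p) \<partial>lebesgue_on B) \<longlonglongrightarrow> 0"
    proof (rule nn_integral_powr_diff_LIMSEQ_0)
      show "(\<lambda>n. \<integral>\<^sup>+x. ennreal (norm (gradient (\<phi> n) x - g x) powr p) \<partial>lebesgue_on B) \<longlonglongrightarrow> 0"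
        using \<phi>g B ball by (intro nn_integral_restrict_LIMSEQ_0_mono[OF _ B(2)]) auto
      show "(\<lambda>n. \<integral>\<^sup>+x. ennreal (norm (gradient (\<phi>' n) x - g' x) powr p) \<partial>lebesgue_on B) \<longlonglongrightarrow> 0"
        using \<phi>g' B ball by (intro nn_integral_restrict_LIMSEQ_0_mono[OF _ B(3)]) auto
    qed (use \<open>1 \<le> p\<close> in auto)
    then show "(\<lambda>n. \<integral>\<^sup>+x. ennreal (norm (gradient (\<lambda>x. \<phi> n x - \<phi>' n x) x - (g x - g' x)) powr p)
        \<partial>lebesgue_on (\<Omega> \<inter> ball z \<rho>)) \<longlonglongrightarrow> 0"
      unfolding eq2 by (simp add: B_def)
    have "(\<lambda>n. \<integral>\<^sup>+x. ennreal (norm (\<phi> n x - h x - (\<phi>' n x - k x)) powr p) \<partial>restrict_space ?H E) \<longlonglongrightarrow> 0"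
    proof (rule nn_integral_powr_diff_LIMSEQ_0)
      show "(\<lambda>n. \<integral>\<^sup>+x. ennreal (norm (\<phi> n x - h x) powr p) \<partial>restrict_space ?H E) \<longlonglongrightarrow> 0"
        using \<phi>h unfolding restr real_norm_def by (rule nn_integral_restrict_LIMSEQ_0_mono[OF _ subE(1) sE])
      show "(\<lambda>n. \<integral>\<^sup>+x. ennreal (norm (\<phi>' n x - k x) powr p) \<partial>restrict_space ?H E) \<longlonglongrightarrow> 0"
        using \<phi>k unfolding restr real_norm_def by (rule nn_integral_restrict_LIMSEQ_0_mono[OF _ subE(2) sE])
      show "(\<lambda>x. \<phi> n x - h x) \<in> borel_measurable (restrict_space ?H E)"
        "(\<lambda>x. \<phi>' n x - k x) \<in> borel_measurable (restrict_space ?H E)" for n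
        by (intro mE; measurable)+
    qed (use \<open>1 \<le> p\<close> in simp)
    then show "(\<lambda>n. \<integral>\<^sup>+x\<in>frontier \<Omega> \<inter> ball z \<rho>. ennreal (\<bar>\<phi> n x - \<phi>' n x - (h x - k x)\<bar> powr p) \<partial>?H) \<longlonglongrightarrow> 0"
      unfolding eq3 restr real_norm_def E_def .
  qed
qed

section \<open>Comparison of energies\<close>

lemma trace_eq_diff:
  fixes \<Omega> :: "'a::euclidean_space set"
  assumes "trace_eq p \<Omega> S v \<psi>" "trace_eq p \<Omega> T w \<psi>" "T \<subseteq> S" "1 \<le> p" "open \<Omega>"
  shows "trace_eq p \<Omega> T (\<lambda>x. v x - w x) (\<lambda>_. 0)"
proof -
  have "S \<inter> T = T"
    using \<open>T \<subseteq> S\<close> by blast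
  then show ?thesis
    using has_trace_diff[OF assms(1,2)[unfolded trace_eq_def] assms(4,5)] by (simp add: trace_eq_def)
qed

text \<open>
  The stress of a field of finite energy has the dual integrability.
\<close>
lemma Lp_space_gradient_integrand:
  fixes f :: "'a::euclidean_space \<Rightarrow> 'a \<Rightarrow> real"
  assumes car: "caratheodory \<Omega> f" and gr: "AE x in lebesgue_on \<Omega>. convex_power_growth (f x) a b p"
    and w: "w \<in> Lp_space p \<Omega>" and q: "q = p / (p - 1)" and \<Omega>: "bounded \<Omega>" "\<Omega> \<in> sets lebesgue"
  shows "(\<lambda>x. gradient (f x) (w x)) \<in> Lp_space q \<Omega>"
proof (rule Lp_space_growth[OF w _ \<Omega>])
  interpret complete_measure "lebesgue_on \<Omega>"
    by (rule complete_measure_lebesgue_on[OF \<Omega>(2)])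
  have f: "\<And>\<xi>. (\<lambda>x. f x \<xi>) \<in> borel_measurable (lebesgue_on \<Omega>)"
    "AE x in lebesgue_on \<Omega>. continuous_on UNIV (f x)"
    using car by (simp_all add: caratheodory_def)
  have [measurable]: "w \<in> borel_measurable (lebesgue_on \<Omega>)"
    using w by (simp add: Lp_space_def)
  show "(\<lambda>x. gradient (f x) (w x)) \<in> borel_measurable (lebesgue_on \<Omega>)"
  proof (rule borel_measurable_gradient_comp)
    show "(\<lambda>x. f x (w x + e)) \<in> borel_measurable (lebesgue_on \<Omega>)" for e
      by (rule borel_measurable_Caratheodory_comp[OF f]) measurable
    show "AE x in lebesgue_on \<Omega>. f x differentiable at (w x)"
      using gr by eventually_elim (simp add: convex_power_growth_def C1_fun_def)
  qed
  let ?C = "(b * (2 powr p + 1)) powr q * 2 powr p"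
  show "AE x in lebesgue_on \<Omega>. norm (gradient (f x) (w x)) powr q \<le> ?C * norm (w x) powr p + ?C"
    using gr
  proof eventually_elim
    case (elim x)
    from convex_power_growth.gradient_growth[OF this q, of "w x"] show ?case
      by (simp add: algebra_simps)
  qed
qed

lemma Lp_space_gradient_conjugate:
  fixes f :: "'a::euclidean_space \<Rightarrow> 'a \<Rightarrow> real"
  assumes car: "caratheodory \<Omega> f" and gr: "AE x in lebesgue_on \<Omega>. convex_power_growth (f x) a b p"
    and \<tau>: "\<tau> \<in> Lp_space q \<Omega>" and q: "q = p / (p - 1)" and \<Omega>: "bounded \<Omega>" "\<Omega> \<in> sets lebesgue"
  shows "(\<lambda>x. gradient (convex_conjugate (f x)) (\<tau> x)) \<in> Lp_space p \<Omega>"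
proof (rule Lp_space_growth[OF \<tau> _ \<Omega>])
  interpret complete_measure "lebesgue_on \<Omega>"
    by (rule complete_measure_lebesgue_on[OF \<Omega>(2)])
  have f: "\<And>\<xi>. (\<lambda>x. f x \<xi>) \<in> borel_measurable (lebesgue_on \<Omega>)"
    "AE x in lebesgue_on \<Omega>. continuous_on UNIV (f x)"
    using car by (simp_all add: caratheodory_def)
  have [measurable]: "\<tau> \<in> borel_measurable (lebesgue_on \<Omega>)"
    using \<tau> by (simp add: Lp_space_def)
  show "(\<lambda>x. gradient (convex_conjugate (f x)) (\<tau> x)) \<in> borel_measurable (lebesgue_on \<Omega>)"
  proof (rule borel_measurable_gradient_comp)
    show "(\<lambda>x. convex_conjugate (f x) (\<tau> x + e)) \<in> borel_measurable (lebesgue_on \<Omega>)" for e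
    proof (rule borel_measurable_convex_conjugate[OF f])
      show "AE x in lebesgue_on \<Omega>. bdd_above (range (\<lambda>\<xi>. (\<tau> x + e) \<bullet> \<xi> - f x \<xi>))"
        using gr by eventually_elim (rule convex_power_growth.conjugate_bdd_above)
    qed measurable
    show "AE x in lebesgue_on \<Omega>. convex_conjugate (f x) differentiable at (\<tau> x)"
      using gr by eventually_elim (rule convex_power_growth.conjugate_differentiable)
  qed
  show "AE x in lebesgue_on \<Omega>. norm (gradient (convex_conjugate (f x)) (\<tau> x)) powr p
      \<le> (1 / a) powr q * norm (\<tau> x) powr q + 0"
    using gr by eventually_elim (simp add: convex_power_growth.gradient_conjugate_growth[OF _ q])
qed

text \<open>
  Integrate \<open>energy_difference_le\<close> over \<open>\<Omega> - \<Gamma>\<close>, where \<open>\<tau>\<close> is orthogonal to \<open>w - w'\<close>, and use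
  that the remaining integrand is nonnegative on all of \<open>\<Omega>\<close>.
\<close>
lemma energy_gap_le_duality_gap:
  fixes f :: "'a::euclidean_space \<Rightarrow> 'a \<Rightarrow> real"
  assumes "open \<Omega>" "bounded \<Omega>" "closed \<Gamma>" "1 < p" and q: "q = p / (p - 1)"
    and car: "caratheodory \<Omega> f" and gr: "AE x in lebesgue_on \<Omega>. convex_power_growth (f x) a b p"
    and w: "w \<in> Lp_space p \<Omega>" and w': "w' \<in> Lp_space p (\<Omega> - \<Gamma>)" and \<tau>: "\<tau> \<in> Lp_space q \<Omega>"
    and orth: "(LINT x|lebesgue_on (\<Omega> - \<Gamma>). \<tau> x \<bullet> (w x - w' x)) = 0"
  defines "\<sigma> \<equiv> \<lambda>x. gradient (f x) (w x)"
  shows "(LINT x|lebesgue_on (\<Omega> - \<Gamma>). f x (w x) - f x (w' x))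
       \<le> (LINT x|lebesgue_on \<Omega>. (\<tau> x - \<sigma> x) \<bullet>
            (gradient (convex_conjugate (f x)) (\<tau> x) - gradient (convex_conjugate (f x)) (\<sigma> x)))"
    (is "?L \<le> integral\<^sup>L _ ?R'")
proof -
  let ?N = "\<Omega> - \<Gamma>"
  have \<Omega>: "\<Omega> \<in> sets lebesgue" and N: "?N \<in> sets lebesgue" "?N \<subseteq> \<Omega>"
    using \<open>open \<Omega>\<close> \<open>closed \<Gamma>\<close> by (auto intro: borel_open borel_closed)
  interpret complete_measure "lebesgue_on \<Omega>"
    by (rule complete_measure_lebesgue_on[OF \<Omega>])
  define \<eta> where "\<eta> = (\<lambda>x. gradient (convex_conjugate (f x)) (\<tau> x))"
  define R where "R = (\<lambda>x. (\<tau> x - \<sigma> x) \<bullet> (\<eta> x - w x))"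
  have Lp: "\<sigma> \<in> Lp_space q \<Omega>" "\<eta> \<in> Lp_space p \<Omega>"
    unfolding \<sigma>_def \<eta>_def
    by (rule Lp_space_gradient_integrand[OF car gr w q \<open>bounded \<Omega>\<close> \<Omega>]
        Lp_space_gradient_conjugate[OF car gr \<tau> q \<open>bounded \<Omega>\<close> \<Omega>])+
  have "0 \<le> q"
    using \<open>1 < p\<close> q by simp
  have R: "integrable (lebesgue_on \<Omega>) R"
    unfolding R_def using \<open>1 < p\<close> \<open>0 \<le> q\<close>
    by (intro integrable_inner_Lp_space[OF _ _ \<open>1 < p\<close> q] Lp_space_diff \<tau> Lp w) auto
  have "AE x in lebesgue_on \<Omega>. R x = ?R' x"
    using gr
  proof eventually_elim
    case (elim x)
    then show ?case
      by (simp add: R_def \<eta>_def \<sigma>_def convex_power_growth.gradient_conjugate_gradient)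
  qed
  then have RR': "integral\<^sup>L (lebesgue_on \<Omega>) R = integral\<^sup>L (lebesgue_on \<Omega>) ?R'"
    using R borel_measurable_AE_eq[of R ?R'] by (intro integral_cong_AE) auto
  have R0: "AE x in lebesgue_on \<Omega>. 0 \<le> R x"
    using gr unfolding R_def \<eta>_def \<sigma>_def
    by eventually_elim (rule convex_power_growth.gradient_conjugate_monotone)
  have le: "AE x in lebesgue_on ?N. f x (w x) - f x (w' x) \<le> R x + \<tau> x \<bullet> (w x - w' x)"
  proof -
    have "AE x in lebesgue_on \<Omega>. f x (w x) - f x (w' x) \<le> R x + \<tau> x \<bullet> (w x - w' x)"
      using gr unfolding R_def \<eta>_def \<sigma>_def
      by eventually_elim (rule convex_power_growth.energy_difference_le)
    then show ?thesis
      using \<Omega> N by (auto simp: AE_restrict_space_iff)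
  qed
  \<comment> \<open>If the energy gap is not integrable, its integral is zero by convention.\<close>
  have "?L \<le> integral\<^sup>L (lebesgue_on \<Omega>) R"
  proof (cases "integrable (lebesgue_on ?N) (\<lambda>x. f x (w x) - f x (w' x))")
    case True
    have RN: "integrable (lebesgue_on ?N) R"
      using R N \<Omega> by (intro integrable_lebesgue_on_mono[OF R])
    have T: "integrable (lebesgue_on ?N) (\<lambda>x. \<tau> x \<bullet> (w x - w' x))"
      using \<open>1 < p\<close>
      by (intro integrable_inner_Lp_space[OF _ _ \<open>1 < p\<close> q] Lp_space_diff w'
          Lp_space_mono[OF \<tau> N(2,1) \<Omega>] Lp_space_mono[OF w N(2,1) \<Omega>]) auto
    have "?L \<le> (LINT x|lebesgue_on ?N. R x + \<tau> x \<bullet> (w x - w' x))"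
      using True RN T le by (intro integral_mono_AE) auto
    also have "\<dots> = integral\<^sup>L (lebesgue_on ?N) R"
      using RN T orth by simp
    also have "\<dots> \<le> integral\<^sup>L (lebesgue_on \<Omega>) R"
      using R0 R N \<Omega> by (intro integral_mono_lebesgue_on_AE) auto
    finally show ?thesis .
  next
    case False
    then show ?thesis
      using R0 by (simp add: not_integrable_integral_eq integral_nonneg_AE)
  qed
  then show ?thesis
    by (simp only: RR')
qed

theorem theorem2p1:
  fixes \<Omega> D \<Gamma> :: "'a::euclidean_space set"
    and p q a b :: real
    and f :: "'a \<Rightarrow> 'a \<Rightarrow> real"
    and \<psi> u u\<Gamma> :: "'a \<Rightarrow> real"
    and Du Du\<Gamma> \<sigma> \<tau> :: "'a \<Rightarrow> 'a"
  assumes "open \<Omega>" "bounded \<Omega>" "connected \<Omega>" "lipschitz_boundary \<Omega>"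
    and "openin (top_of_set (frontier \<Omega>)) D"
    and "1 < p" and "q = p / (p - 1)"
    and "caratheodory \<Omega> f"
    and "AE x in lebesgue_on \<Omega>. strictly_convex (f x)"
    and "AE x in lebesgue_on \<Omega>. C1_fun (f x)"
    and "AE x in lebesgue_on \<Omega>. f x 0 = 0"
    and "0 < a" and "0 < b"
    and "AE x in lebesgue_on \<Omega>. \<forall>\<xi>. a * norm \<xi> powr p \<le> f x \<xi> \<and> f x \<xi> \<le> b * (norm \<xi> powr p + 1)"
    and "\<psi> \<in> W1p_space p \<Omega>" and "\<psi> \<in> Linf_space \<Omega>"
    and "closed \<Gamma>" and "\<Gamma> \<subseteq> closure \<Omega>"
    and "is_minimizer p f \<psi> \<Omega> D {} u Du"
    and "is_minimizer p f \<psi> \<Omega> D \<Gamma> u\<Gamma> Du\<Gamma>"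
    and "\<sigma> = (\<lambda>x. gradient (f x) (Du x))"
    and "\<tau> \<in> Lp_space q \<Omega>"
    and "\<forall>v \<in> admissible_variations p \<Omega> D \<Gamma>. \<forall>Dv. has_weak_gradient p (\<Omega> - \<Gamma>) v Dv \<longrightarrow>
           (LINT x|lebesgue_on (\<Omega> - \<Gamma>). \<tau> x \<bullet> Dv x) = 0"
  shows "(LINT x|lebesgue_on (\<Omega> - \<Gamma>). f x (Du x) - f x (Du\<Gamma> x))
       \<le> (LINT x|lebesgue_on \<Omega>. (\<tau> x - \<sigma> x) \<bullet>
            (gradient (convex_conjugate (f x)) (\<tau> x) - gradient (convex_conjugate (f x)) (\<sigma> x)))"
proof -
  note open_\<Omega> = assms(1) and bounded_\<Omega> = assms(2) and p = assms(6) and q = assms(7)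
    and sc = assms(9) and C1 = assms(10) and zero = assms(11) and a = assms(12) and b = assms(13)
    and growth = assms(14) and closed_\<Gamma> = assms(17) and u = assms(19) and u\<Gamma> = assms(20)
  have gr: "AE x in lebesgue_on \<Omega>. convex_power_growth (f x) a b p"
    using sc C1 zero growth by eventually_elim (use p a b in \<open>auto simp: convex_power_growth_def\<close>)
  have N: "\<Omega> - \<Gamma> \<in> sets lebesgue" "\<Omega> \<in> sets lebesgue" "bounded (\<Omega> - \<Gamma>)"
    using open_\<Omega> bounded_\<Omega> closed_\<Gamma> by (auto intro: borel_open borel_closed bounded_subset)
  have Du: "has_weak_gradient p \<Omega> u Du" and Du\<Gamma>: "has_weak_gradient p (\<Omega> - \<Gamma>) u\<Gamma> Du\<Gamma>"
    using u u\<Gamma> by (simp_all add: is_minimizer_def)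
  have diff: "has_weak_gradient p (\<Omega> - \<Gamma>) (\<lambda>x. u x - u\<Gamma> x) (\<lambda>x. Du x - Du\<Gamma> x)"
    using p by (intro has_weak_gradient_diff has_weak_gradient_mono[OF Du] Du\<Gamma> N) auto
  moreover have "trace_eq p \<Omega> (D - \<Gamma>) (\<lambda>x. u x - u\<Gamma> x) (\<lambda>_. 0)"
  proof (rule trace_eq_diff)
    show "trace_eq p \<Omega> D u \<psi>" "trace_eq p \<Omega> (D - \<Gamma>) u\<Gamma> \<psi>"
      using u u\<Gamma> by (simp_all add: is_minimizer_def)
  qed (use p open_\<Omega> in auto)
  ultimately have "(\<lambda>x. u x - u\<Gamma> x) \<in> admissible_variations p \<Omega> D \<Gamma>"
    by (auto simp: admissible_variations_def W1p_space_def)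
  with diff have "(LINT x|lebesgue_on (\<Omega> - \<Gamma>). \<tau> x \<bullet> (Du x - Du\<Gamma> x)) = 0"
    using assms(23) by blast
  moreover have "Du \<in> Lp_space p \<Omega>" "Du\<Gamma> \<in> Lp_space p (\<Omega> - \<Gamma>)"
    using Du Du\<Gamma> by (simp_all add: has_weak_gradient_def)
  ultimately show ?thesis
    unfolding assms(21)
    using energy_gap_le_duality_gap[OF open_\<Omega> bounded_\<Omega> closed_\<Gamma> p q assms(8) gr _ _ assms(22)] by blast
qed

end
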